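(* Let $Q:\mathbb{T}^n\to[0,+\infty)$ be real analytic with zero set $\mathscr{Z}=\{\Phi\in\mathbb{T}^n:Q(\Phi)=0\}$ nonempty and finite, let $\Phi_0\in\mathbb{T}^n$, and let $\Phi\in\mathscr{A}$ be a global minimizer over $\mathscr{A}$ of $$K(\Phi)=\int_0^\infty\tfrac12\|\dot\Phi\|^2+Q(\Phi)\,dt .$$ Let $\overline\Phi\in\mathscr{Z}$ denote the limit of $\Phi(t)$ as $t\to+\infty$ (which exists under the preceding hypotheses). Assume in addition that the Hessian $\nabla^2Q(\overline\Phi)$ is (strictly) positive definite. Then there are constants $C,\mu>0$ independent of $t$ such that, for any $t\ge0$, $$\|\Phi(t)-\overline\Phi\|+\|\dot\Phi(t)\|+|Q(\Phi(t))|\le C e^{-\mu t}.$$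
   Context: $\mathbb{T}=\mathbb{R}/2\pi\mathbb{Z}$; for points of $\mathbb{T}^n$, $\|\Phi-\Psi\|$ denotes the (quotient) Euclidean distance on the flat torus. $H^1_{loc}([0,+\infty);\mathbb{T}^n)$ is the set of maps $\Phi:[0,+\infty)\to\mathbb{T}^n$ belonging to $H^1((0,T);\mathbb{T}^n)$ for every $T>0$ (continuous, weakly differentiable with $\dot\Phi\in L^2((0,T);\mathbb{R}^n)$). The set of admissible trajectories is $$\mathscr{A}=\left\{\Phi\in H^1_{loc}([0,+\infty);\mathbb{T}^n)\ :\ \Phi(0)=\Phi_0,\ \tfrac12\|\dot\Phi\|^2+Q(\Phi)\in L^1(0,+\infty)\right\}.$$ *)

theory Defs
  imports "HOL-Analysis.Analysis"
begin

section \<open>The flat torus\<close>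

definition torus_rel :: "real ^ 'n \<Rightarrow> real ^ 'n \<Rightarrow> bool" where
  "torus_rel x y \<longleftrightarrow> (\<forall>i. \<exists>k::int. x $ i - y $ i = 2 * pi * of_int k)"

lemma torus_rel_equivp: "equivp torus_rel"
proof (rule equivpI)
  show "reflp torus_rel"
    unfolding reflp_def torus_rel_def by (metis diff_self mult_zero_right of_int_0)
  show "symp torus_rel"
    unfolding symp_def torus_rel_def by (metis minus_diff_eq mult_minus_right of_int_minus)
  show "transp torus_rel"
  proof (rule transpI)
    fix x y z :: "real ^ 'n"
    assume xy: "torus_rel x y" and yz: "torus_rel y z"
    show "torus_rel x z"
      unfolding torus_rel_def
    proof
      fix i
      from xy yz obtain k l :: int
        where "x $ i - y $ i = 2 * pi * of_int k" "y $ i - z $ i = 2 * pi * of_int l"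
        unfolding torus_rel_def by metis
      then have "x $ i - z $ i = 2 * pi * of_int (k + l)"
        by (simp add: algebra_simps)
      then show "\<exists>m::int. x $ i - z $ i = 2 * pi * of_int m" by blast
    qed
  qed
qed

quotient_type 'n torus = "real ^ 'n" / torus_rel
  by (rule torus_rel_equivp)

lemma abs_torus_eq_iff:
  "abs_torus x = abs_torus y \<longleftrightarrow> torus_rel x y"
  by (rule torus.abs_eq_iff)

lemma abs_torus_rep_torus [simp]: "abs_torus (rep_torus p) = p"
  by (rule Quotient3_abs_rep[OF Quotient3_torus])

instantiation torus :: (finite) metric_space
begin

definition dist_torus :: "'a torus \<Rightarrow> 'a torus \<Rightarrow> real" where
  "dist_torus p q = (INF (x, y) \<in> {(x, y). abs_torus x = p \<and> abs_torus y = q}. norm (x - y))"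

definition uniformity_torus :: "('a torus \<times> 'a torus) filter" where
  "uniformity_torus = (INF e\<in>{0<..}. principal {(x, y). dist x y < e})"

definition open_torus :: "'a torus set \<Rightarrow> bool" where
  "open_torus U \<longleftrightarrow> (\<forall>x\<in>U. \<forall>\<^sub>F (x', y) in uniformity. x' = x \<longrightarrow> y \<in> U)"

lemma dist_torus_lower:
  fixes x y :: "real ^ 'a"
  shows "dist (abs_torus x) (abs_torus y) \<le> norm (x - y)"
  unfolding dist_torus_def
  by (rule cINF_lower2[where x = "(x, y)"]) (auto intro!: bdd_belowI2[where m = 0])

lemma dist_torus_approx:
  fixes p q :: "'a torus"
  assumes "dist p q < e"
  obtains x y where "abs_torus x = p" "abs_torus y = q" "norm (x - y) < e"
proof -
  let ?S = "{(x, y). abs_torus x = p \<and> abs_torus y = q}"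
  have "(rep_torus p, rep_torus q) \<in> ?S" by simp
  then have ne: "?S \<noteq> {}" by blast
  have bdd: "bdd_below ((\<lambda>(x, y). norm (x - y)) ` ?S)"
    by (auto intro!: bdd_belowI2[where m = 0])
  from assms show ?thesis
    unfolding dist_torus_def cINF_less_iff[OF ne bdd] using that by auto
qed

lemma dist_torus_nonneg: "0 \<le> dist (p :: 'a torus) q"
proof (rule ccontr)
  assume "\<not> 0 \<le> dist p q"
  then have "dist p q < 0" by simp
  then obtain x y :: "real ^ 'a" where "norm (x - y) < 0"
    by (rule dist_torus_approx)
  then show False by simp
qed

instance
proof
  show "uniformity = (INF e\<in>{0<..}. principal {(x :: 'a torus, y). dist x y < e})"
    by (rule uniformity_torus_def)
next
  fix U :: "'a torus set"
  show "open U \<longleftrightarrow> (\<forall>x\<in>U. \<forall>\<^sub>F (x', y) in uniformity. x' = x \<longrightarrow> y \<in> U)"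
    by (rule open_torus_def)
next
  fix p q :: "'a torus"
  show "dist p q = 0 \<longleftrightarrow> p = q"
  proof
    assume "p = q"
    then have "dist p q \<le> 0"
      using dist_torus_lower[of "rep_torus p" "rep_torus q"] by simp
    then show "dist p q = 0" using dist_torus_nonneg[of p q] by simp
  next
    assume d0: "dist p q = 0"
    let ?a = "rep_torus p" and ?b = "rep_torus q"
    have "torus_rel ?a ?b"
      unfolding torus_rel_def
    proof
      fix i
      define d where "d = (?a $ i - ?b $ i) / (2 * pi)"
      have "d = of_int (round d)"
      proof (rule ccontr)
        assume ne: "d \<noteq> of_int (round d)"
        define e where "e = 2 * pi * \<bar>d - of_int (round d)\<bar>"
        have "e > 0" using ne by (simp add: e_def)
        then have "dist p q < e" using d0 by simp
        then obtain x y where x: "abs_torus x = p" and y: "abs_torus y = q"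
          and xy: "norm (x - y) < e"
          by (rule dist_torus_approx)
        have "torus_rel x ?a" "torus_rel y ?b"
          using x y by (simp_all flip: abs_torus_eq_iff)
        then obtain k l :: int where "x $ i - ?a $ i = 2 * pi * of_int k"
          "y $ i - ?b $ i = 2 * pi * of_int l"
          unfolding torus_rel_def by metis
        then have eq: "(x - y) $ i = 2 * pi * (d - of_int (l - k))"
          by (simp add: d_def field_simps)
        have "\<bar>d - of_int (round d)\<bar> \<le> \<bar>d - of_int (l - k)\<bar>"
          by (rule round_diff_minimal)
        then have "e \<le> \<bar>(x - y) $ i\<bar>"
          unfolding eq e_def by (simp add: abs_mult)
        also have "\<dots> \<le> norm (x - y)" by (rule component_le_norm_cart)
        finally show False using xy by simp
      qed
      then have "?a $ i - ?b $ i = 2 * pi * of_int (round d)"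
        by (simp add: d_def field_simps)
      then show "\<exists>k::int. ?a $ i - ?b $ i = 2 * pi * of_int k" by blast
    qed
    then have "abs_torus ?a = abs_torus ?b" by (simp only: abs_torus_eq_iff)
    then show "p = q" by simp
  qed
next
  fix p q r :: "'a torus"
  show "dist p q \<le> dist p r + dist q r"
  proof (rule field_le_epsilon)
    fix e :: real
    assume "0 < e"
    then have "dist p r < dist p r + e / 2" "dist q r < dist q r + e / 2" by simp_all
    then obtain x z y z' where
      x: "abs_torus x = p" and z: "abs_torus z = r" and xz: "norm (x - z) < dist p r + e / 2" and
      y: "abs_torus y = q" and z': "abs_torus z' = r" and yz: "norm (y - z') < dist q r + e / 2"
      by (meson dist_torus_approx)
    have "torus_rel z z'" using z z' by (simp flip: abs_torus_eq_iff)
    then have "torus_rel (y + (z - z')) y" by (simp add: torus_rel_def)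
    then have "abs_torus (y + (z - z')) = q" using y by (simp flip: abs_torus_eq_iff)
    then have "dist p q \<le> norm (x - (y + (z - z')))"
      using dist_torus_lower[of x "y + (z - z')"] x by simp
    also have "x - (y + (z - z')) = (x - z) - (y - z')" by simp
    also have "norm \<dots> \<le> norm (x - z) + norm (y - z')" by (rule norm_triangle_ineq4)
    finally show "dist p q \<le> dist p r + dist q r + e" using xz yz by simp
  qed
qed

end


section \<open>Real analytic functions and Hessians\<close>

text \<open>Monomials are indexed by multi-indices of type \<^typ>\<open>'n \<Rightarrow> nat\<close>.\<close>

definition real_analytic :: "(real ^ 'n \<Rightarrow> real) \<Rightarrow> bool" where
  "real_analytic f \<longleftrightarrow>
     (\<forall>x. \<exists>r>0. \<exists>a :: ('n \<Rightarrow> nat) \<Rightarrow> real. \<forall>y\<in>ball x r.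
        ((\<lambda>\<alpha>. a \<alpha> * (\<Prod>i\<in>UNIV. (y $ i - x $ i) ^ \<alpha> i)) has_sum f y) UNIV)"

definition torus_real_analytic :: "('n::finite torus \<Rightarrow> real) \<Rightarrow> bool" where
  "torus_real_analytic Q \<longleftrightarrow> real_analytic (\<lambda>x. Q (abs_torus x))"

definition partial_deriv :: "'n \<Rightarrow> (real ^ 'n \<Rightarrow> real) \<Rightarrow> real ^ 'n \<Rightarrow> real" where
  "partial_deriv i f x = deriv (\<lambda>s. f (x + s *\<^sub>R axis i 1)) 0"

definition hessian :: "(real ^ 'n \<Rightarrow> real) \<Rightarrow> real ^ 'n \<Rightarrow> real ^ 'n ^ 'n" where
  "hessian f x = (\<chi> i j. partial_deriv i (partial_deriv j f) x)"

text \<open>By periodicity of the lifted function, the choice of representative is irrelevant.\<close>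

definition torus_hessian :: "('n::finite torus \<Rightarrow> real) \<Rightarrow> 'n torus \<Rightarrow> real ^ 'n ^ 'n" where
  "torus_hessian Q p = hessian (\<lambda>x. Q (abs_torus x)) (rep_torus p)"

definition positive_definite :: "real ^ 'n ^ 'n \<Rightarrow> bool" where
  "positive_definite A \<longleftrightarrow> (\<forall>v. v \<noteq> 0 \<longrightarrow> 0 < v \<bullet> (A *v v))"


section \<open>Sobolev curves in the torus\<close>

definition L2_on :: "real set \<Rightarrow> (real \<Rightarrow> 'b::euclidean_space) \<Rightarrow> bool" where
  "L2_on S u \<longleftrightarrow> set_borel_measurable lebesgue S u \<and>
     set_integrable lebesgue S (\<lambda>t. (norm (u t))\<^sup>2)"

text \<open>Test functions are compactly supported and continuously differentiable, as in Brezis'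
  treatment of Sobolev spaces on intervals; by mollification, smooth test functions would give the
  same weak derivative.\<close>

definition test_function_on :: "real set \<Rightarrow> (real \<Rightarrow> real) \<Rightarrow> bool" where
  "test_function_on S \<eta> \<longleftrightarrow>
     \<eta> differentiable_on UNIV \<and> continuous_on UNIV (deriv \<eta>) \<and>
     (\<exists>K. compact K \<and> K \<subseteq> S \<and> (\<forall>t. t \<notin> K \<longrightarrow> \<eta> t = 0))"

definition has_weak_derivative_on ::
    "(real \<Rightarrow> 'b::euclidean_space) \<Rightarrow> (real \<Rightarrow> 'b) \<Rightarrow> real set \<Rightarrow> bool" where
  "has_weak_derivative_on \<phi> u S \<longleftrightarrow>
     (\<forall>\<eta>. test_function_on S \<eta> \<longrightarrow>
        (LINT t:S|lebesgue. deriv \<eta> t *\<^sub>R \<phi> t) = - (LINT t:S|lebesgue. \<eta> t *\<^sub>R u t))"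

text \<open>A curve in the torus is only considered at times \<open>t \<ge> 0\<close>; its weak derivative is that of a
  continuous lift to Euclidean space, and does not depend on the lift.\<close>

definition weak_velocity_of :: "(real \<Rightarrow> 'n::finite torus) \<Rightarrow> (real \<Rightarrow> real ^ 'n) \<Rightarrow> bool" where
  "weak_velocity_of \<Phi> u \<longleftrightarrow>
     (\<exists>\<phi>. continuous_on {0..} \<phi> \<and> (\<forall>t\<ge>0. abs_torus (\<phi> t) = \<Phi> t) \<and>
       (\<forall>T>0. L2_on {0<..<T} \<phi> \<and> L2_on {0<..<T} u \<and> has_weak_derivative_on \<phi> u {0<..<T}))"

definition H1_loc :: "(real \<Rightarrow> 'n::finite torus) set" where
  "H1_loc = {\<Phi>. \<exists>u. weak_velocity_of \<Phi> u}"

text \<open>Weak velocities are unique up to null sets.\<close>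

definition weak_velocity :: "(real \<Rightarrow> 'n::finite torus) \<Rightarrow> real \<Rightarrow> real ^ 'n" where
  "weak_velocity \<Phi> = (SOME u. weak_velocity_of \<Phi> u)"

definition lagrangian ::
    "('n::finite torus \<Rightarrow> real) \<Rightarrow> (real \<Rightarrow> 'n torus) \<Rightarrow> real \<Rightarrow> real" where
  "lagrangian Q \<Phi> t = 1 / 2 * (norm (weak_velocity \<Phi> t))\<^sup>2 + Q (\<Phi> t)"

definition admissible ::
    "('n::finite torus \<Rightarrow> real) \<Rightarrow> 'n torus \<Rightarrow> (real \<Rightarrow> 'n torus) set" where
  "admissible Q \<Phi>0 =
     {\<Phi> \<in> H1_loc. \<Phi> 0 = \<Phi>0 \<and> set_integrable lebesgue {0<..} (lagrangian Q \<Phi>)}"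

definition action :: "('n::finite torus \<Rightarrow> real) \<Rightarrow> (real \<Rightarrow> 'n torus) \<Rightarrow> real" where
  "action Q \<Phi> = (LINT t:{0<..}|lebesgue. lagrangian Q \<Phi> t)"

definition global_minimizer ::
    "('n::finite torus \<Rightarrow> real) \<Rightarrow> 'n torus \<Rightarrow> (real \<Rightarrow> 'n torus) \<Rightarrow> bool" where
  "global_minimizer Q \<Phi>0 \<Phi> \<longleftrightarrow>
     \<Phi> \<in> admissible Q \<Phi>0 \<and> (\<forall>\<Psi>\<in>admissible Q \<Phi>0. action Q \<Phi> \<le> action Q \<Psi>)"

text \<open>The classical velocity, one-sided at time \<open>0\<close>. No continuity of the lift away from \<open>t\<close> is
  needed: two lifts that are differentiable at \<open>t\<close> differ by a constant near \<open>t\<close>, so \<open>v\<close> is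
  unique.\<close>

definition has_velocity ::
    "(real \<Rightarrow> 'n::finite torus) \<Rightarrow> real ^ 'n \<Rightarrow> real \<Rightarrow> bool" where
  "has_velocity \<Phi> v t \<longleftrightarrow>
     (\<exists>\<phi>. (\<forall>s\<ge>0. abs_torus (\<phi> s) = \<Phi> s) \<and> (\<phi> has_vector_derivative v) (at t within {0..}))"

end

theory Submission
  imports Defs
begin

text \<open>Let \<open>q\<close> be the lift of \<open>Q\<close> to Euclidean space and \<open>\<phi>\<close> a continuous lift of \<open>\<Phi>\<close>. The first
  variation of the action along \<open>\<phi> + s \<eta> e\<close>, with \<open>\<eta>\<close> compactly supported in \<open>(0, \<infinity>)\<close>, says that the
  weak velocity of \<open>\<phi>\<close> has weak derivative \<open>\<nabla>q(\<phi>)\<close>. By the du Bois-Reymond lemma \<open>\<phi>\<close> is then twice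
  continuously differentiable up to time \<open>0\<close> and satisfies Newton's equation \<open>\<phi>'' = \<nabla>q(\<phi>)\<close>. The
  energy \<open>|\<phi>'|^2 / 2 - q(\<phi>)\<close> is constant and dominated by the integrable Lagrangian, hence zero.
  Near the limit \<open>p\<close> of \<open>\<phi>\<close>, nondegeneracy gives \<open>q(y) \<le> C |y - p|^2\<close> and
  \<open>(y - p) \<bullet> \<nabla>q(y) \<ge> c |y - p|^2\<close>, so \<open>G = |\<phi> - p|^2\<close> satisfies \<open>G'' \<ge> 2 c G\<close> and tends to \<open>0\<close>;
  with \<open>\<mu>^2 = 2 c\<close> the function \<open>(G' + \<mu> G) exp(-\<mu> t)\<close> increases to \<open>0\<close>, which forces
  \<open>G' \<le> - \<mu> G\<close>. Zero energy transfers the decay of \<open>G\<close> to \<open>\<phi>'\<close> and \<open>q(\<phi>)\<close>.\<close>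

section \<open>Derivatives of real analytic functions\<close>

text \<open>The velocity in the action is an arbitrary choice among functions that agree almost
  everywhere, so Lagrangians of competitors are known only up to null sets until Newton's equation
  supplies a continuous velocity. The action is not differentiated under the integral: a quadratic
  Taylor bound, uniform on a compact set, gives 0 \<le> s A + s^2 B for all |s| \<le> 1, whence A =
  0. The variations vanish near time 0, but the forcing is continuous on the closed half line, so
  antiderivatives reach down to 0 and regularity there is one-sided. For the decay, G'' - \<mu>^2 G
  = (d/dt - \<mu>)(d/dt + \<mu>) G, and exp(-\<mu> t) is the integrating factor of the outer
  operator. Zero energy is needed already for the limit 0: it bounds |\<phi>'| by a multiple of
  |\<phi> - p|, hence G' by a multiple of G. As G is a squared distance, the final rate is \<mu> /
  2.\<close>

lemma has_derivative_monomial: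
  fixes x y :: "real ^ 'n"
  shows "((\<lambda>y. \<Prod>i\<in>UNIV. (y $ i - x $ i) ^ \<alpha> i) has_derivative
     (\<lambda>h. \<Sum>i\<in>UNIV. h $ i * (real (\<alpha> i) * (y $ i - x $ i) ^ (\<alpha> i - 1) *
        (\<Prod>j\<in>UNIV - {i}. (y $ j - x $ j) ^ \<alpha> j)))) (at y)"
proof -
  have "((\<lambda>y. (y $ i - x $ i) ^ \<alpha> i) has_derivative
     (\<lambda>h. h $ i * (real (\<alpha> i) * (y $ i - x $ i) ^ (\<alpha> i - 1)))) (at y)" for i
    by (rule derivative_eq_intros refl bounded_linear_imp_has_derivative bounded_linear_vec_nth | simp add: fun_eq_iff)+
  from has_derivative_prod[where I = UNIV, OF this] show ?thesis
    by (simp add: mult.assoc)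
qed

text \<open>Halving the radius absorbs the factor \<open>\<alpha> i \<le> 2 ^ \<alpha> i\<close> that differentiation produces, so the
  differentiated power series satisfies the Weierstrass M-test with the original coefficients.\<close>

lemma norm_monomial_derivative_le:
  fixes x y :: "real ^ 'n"
  assumes \<rho>: "0 < \<rho>" and y: "\<And>j. \<bar>y $ j - x $ j\<bar> \<le> \<rho> / 2"
  shows "\<bar>real (\<alpha> i) * (y $ i - x $ i) ^ (\<alpha> i - 1) * (\<Prod>j\<in>UNIV - {i}. (y $ j - x $ j) ^ \<alpha> j)\<bar>
     \<le> 2 / \<rho> * (\<Prod>j\<in>UNIV. \<rho> ^ \<alpha> j)"
proof -
  have "\<bar>\<Prod>j\<in>UNIV - {i}. (y $ j - x $ j) ^ \<alpha> j\<bar> \<le> (\<Prod>j\<in>UNIV - {i}. \<rho> ^ \<alpha> j)"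
    unfolding abs_prod power_abs
  proof (intro prod_mono conjI power_mono)
    show "\<bar>y $ j - x $ j\<bar> \<le> \<rho>" for j using y[of j] \<rho> by linarith
  qed auto
  moreover have "\<bar>real (\<alpha> i) * (y $ i - x $ i) ^ (\<alpha> i - 1)\<bar> \<le> 2 / \<rho> * \<rho> ^ \<alpha> i"
  proof (cases "\<alpha> i")
    case (Suc k)
    have "\<bar>real (\<alpha> i) * (y $ i - x $ i) ^ (\<alpha> i - 1)\<bar> \<le> real (Suc k) * (\<rho> / 2) ^ k"
      unfolding Suc abs_mult power_abs using y[of i] by (auto intro!: mult_left_mono power_mono)
    also have "\<dots> \<le> 2 ^ Suc k * (\<rho> / 2) ^ k"
      using \<rho> of_nat_less_two_power[of "Suc k", where 'a = real]
      by (intro mult_right_mono) auto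
    also have "\<dots> = 2 / \<rho> * \<rho> ^ \<alpha> i" using \<rho> by (simp add: Suc field_simps)
    finally show ?thesis .
  qed (use \<rho> in auto)
  ultimately have "\<bar>real (\<alpha> i) * (y $ i - x $ i) ^ (\<alpha> i - 1) * (\<Prod>j\<in>UNIV - {i}. (y $ j - x $ j) ^ \<alpha> j)\<bar>
     \<le> (2 / \<rho> * \<rho> ^ \<alpha> i) * (\<Prod>j\<in>UNIV - {i}. \<rho> ^ \<alpha> j)"
    unfolding abs_mult[of "real (\<alpha> i) * (y $ i - x $ i) ^ (\<alpha> i - 1)"]
    by (intro mult_mono) (use \<rho> in auto)
  also have "\<dots> = 2 / \<rho> * (\<Prod>j\<in>UNIV. \<rho> ^ \<alpha> j)"
    by (simp add: prod.remove[of UNIV i])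
  finally show ?thesis .
qed

text \<open>The unordered sum converges absolutely at a point whose coordinates are all
  \<open>\<rho>\<close> away from those of \<open>x\<close>. This gives a summable majorant for the
  differentiated series on a smaller ball, hence uniform convergence and termwise differentiation.
  The last conjunct rewrites each partial derivative as a power series with the same centre, which
  lets analyticity pass to derivatives.\<close>

lemma power_series_has_derivative:
  fixes f :: "real ^ 'n \<Rightarrow> real" and x :: "real ^ 'n" and a :: "('n \<Rightarrow> nat) \<Rightarrow> real"
  assumes "0 < r"
    and f: "\<And>y. y \<in> ball x r \<Longrightarrow>
        ((\<lambda>\<alpha>. a \<alpha> * (\<Prod>i\<in>UNIV. (y $ i - x $ i) ^ \<alpha> i)) has_sum f y) UNIV"
  shows "\<exists>s>0. \<exists>G. \<forall>y\<in>ball x s. (f has_derivative (\<lambda>h. \<Sum>i\<in>UNIV. h $ i * G i y)) (at y) \<and>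
    (\<forall>i. ((\<lambda>\<alpha>. (real (\<alpha> i) + 1) * a (\<alpha>(i := \<alpha> i + 1)) * (\<Prod>j\<in>UNIV. (y $ j - x $ j) ^ \<alpha> j))
          has_sum G i y) UNIV)"
proof -
  define \<rho> where "\<rho> = r / (2 * real CARD('n))"
  have \<rho>: "0 < \<rho>" using \<open>0 < r\<close> by (simp add: \<rho>_def)
  \<comment> \<open>The factor \<open>2 * real CARD('n)\<close> in \<open>\<rho>\<close> makes the
    l1 length of \<open>z - x\<close> equal to \<open>r / 2\<close>, so the corner \<open>z\<close>
    of the cube still lies in the ball of convergence.\<close>
  define z where "z = (\<chi> i. x $ i + \<rho>)"
  have "norm (z - x) \<le> (\<Sum>i\<in>UNIV. \<bar>(z - x) $ i\<bar>)" by (rule norm_le_l1_cart)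
  also have "\<dots> = r / 2" using \<rho> by (simp add: z_def) (simp add: \<rho>_def)
  finally have "z \<in> ball x r" using \<open>0 < r\<close> by (simp add: dist_norm norm_minus_commute)
  from f[OF this] have "(\<lambda>\<alpha>. a \<alpha> * (\<Prod>i\<in>UNIV. \<rho> ^ \<alpha> i)) summable_on UNIV"
    by (auto simp: z_def summable_on_def)
  then have "(\<lambda>\<alpha>. \<bar>a \<alpha> * (\<Prod>i\<in>UNIV. \<rho> ^ \<alpha> i)\<bar>) summable_on UNIV"
    using summable_on_iff_abs_summable_on_real by force
  then have "(\<lambda>\<alpha>. 2 / \<rho> * \<bar>a \<alpha> * (\<Prod>i\<in>UNIV. \<rho> ^ \<alpha> i)\<bar>) summable_on UNIV"
    by (rule summable_on_cmult_right)
  moreover have "2 / \<rho> * \<bar>a \<alpha> * (\<Prod>i\<in>UNIV. \<rho> ^ \<alpha> i)\<bar> = \<bar>a \<alpha>\<bar> * (2 / \<rho> * (\<Prod>i\<in>UNIV. \<rho> ^ \<alpha> i))" for \<alpha>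
    using \<rho> by (simp add: abs_mult abs_prod)
  ultimately have Msum: "(\<lambda>\<alpha>. \<bar>a \<alpha>\<bar> * (2 / \<rho> * (\<Prod>i\<in>UNIV. \<rho> ^ \<alpha> i))) summable_on UNIV" by (simp only:)
  define D where "D \<alpha> i y = a \<alpha> * (real (\<alpha> i) * (y $ i - x $ i) ^ (\<alpha> i - 1) *
        (\<Prod>j\<in>UNIV - {i}. (y $ j - x $ j) ^ \<alpha> j))" for \<alpha> i and y :: "real ^ 'n"
  \<comment> \<open>\<open>\<rho> / 2\<close> is the range of the majorant; \<open>r / 2\<close>
    keeps the ball inside the domain of the expansion.\<close>
  define s where "s = min (r / 2) (\<rho> / 2)"
  have s: "0 < s" "s \<le> \<rho> / 2" "s < r" using \<rho> \<open>0 < r\<close> by (auto simp: s_def)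
  have coord: "\<bar>y $ j - x $ j\<bar> \<le> \<rho> / 2" if "y \<in> ball x s" for y j
  proof -
    have "\<bar>y $ j - x $ j\<bar> = \<bar>(y - x) $ j\<bar>" by simp
    also have "\<dots> \<le> norm (y - x)" by (rule component_le_norm_cart)
    also have "\<dots> \<le> \<rho> / 2" using that s by (simp add: dist_norm norm_minus_commute)
    finally show ?thesis .
  qed
  have Dle: "norm (D \<alpha> i y) \<le> \<bar>a \<alpha>\<bar> * (2 / \<rho> * (\<Prod>i\<in>UNIV. \<rho> ^ \<alpha> i))" if "y \<in> ball x s" for \<alpha> i y
    unfolding D_def real_norm_def abs_mult[of "a \<alpha>"]
    by (intro mult_left_mono norm_monomial_derivative_le \<rho> coord that) auto
  define G where "G i y = (\<Sum>\<^sub>\<infinity>\<alpha>. D \<alpha> i y)" for i y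
  have DG: "((\<lambda>\<alpha>. D \<alpha> i y) has_sum G i y) UNIV" if "y \<in> ball x s" for i y
  proof -
    have "(\<lambda>\<alpha>. D \<alpha> i y) summable_on UNIV"
      by (rule abs_summable_summable, rule Infinite_Sum.abs_summable_on_comparison_test'[OF Msum], rule Dle[OF that])
    then show ?thesis unfolding G_def by (rule has_sum_infsum)
  qed
  \<comment> \<open>The M-test and the theorem on differentiating series speak of sequences, so the
    multi-indices are enumerated by a bijection \<open>e\<close>; for unordered sums the order is
    irrelevant.\<close>
  have inf: "infinite (UNIV :: ('n \<Rightarrow> nat) set)"
  proof -
    have "inj (\<lambda>k. (\<lambda>_ :: 'n. k :: nat))" by (auto simp: inj_on_def fun_eq_iff)
    then show ?thesis using finite_imageD infinite_UNIV_nat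
      by (metis finite_subset subset_UNIV)
  qed
  define e where "e = from_nat_into (UNIV :: ('n \<Rightarrow> nat) set)"
  have e: "bij e" unfolding e_def using bij_betw_from_nat_into[OF _ inf] by simp
  have sums: "(\<lambda>n. g (e n)) sums S" if "(g has_sum S) UNIV" for g :: "('n \<Rightarrow> nat) \<Rightarrow> real" and S
    using that has_sum_reindex[of e UNIV g S] e has_sum_imp_sums[of "g \<circ> e" S]
    by (simp add: bij_is_inj bij_is_surj o_def)
  have "summable (\<lambda>n. \<bar>a (e n)\<bar> * (2 / \<rho> * (\<Prod>i\<in>UNIV. \<rho> ^ e n i)))"
    using sums[OF has_sum_infsum[OF Msum]] by (rule sums_summable)
  then have ul: "uniform_limit (ball x s) (\<lambda>n y. \<Sum>k<n. D (e k) i y) (\<lambda>y. suminf (\<lambda>k. D (e k) i y)) sequentially" for i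
    by (rule Weierstrass_m_test[rotated]) (rule Dle)
  have GS: "suminf (\<lambda>k. D (e k) i y) = G i y" if "y \<in> ball x s" for i y
    using sums[OF DG[OF that]] by (simp add: sums_iff)
  have fder: "(f has_derivative (\<lambda>h. \<Sum>i\<in>UNIV. h $ i * G i y)) (at y)" if y: "y \<in> ball x s" for y
  proof -
    let ?f = "\<lambda>n y. a (e n) * (\<Prod>i\<in>UNIV. (y $ i - x $ i) ^ e n i)"
    have "\<exists>g. \<forall>y\<in>ball x s. (\<lambda>n. ?f n y) sums g y \<and>
       (g has_derivative (\<lambda>h. \<Sum>i\<in>UNIV. h $ i * G i y)) (at y within ball x s)"
    proof (rule has_derivative_series[where x = y])
      show "(?f n has_derivative (\<lambda>h. \<Sum>i\<in>UNIV. h $ i * D (e n) i y)) (at y within ball x s)" for n y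
        unfolding D_def
        by (rule has_derivative_at_withinI, rule has_derivative_eq_rhs,
            rule has_derivative_mult_right, rule has_derivative_monomial)
          (simp add: sum_distrib_left mult_ac fun_eq_iff)
      show "(\<lambda>n. ?f n y) sums f y" using sums[OF f[of y]] y s by simp
      fix \<epsilon> :: real assume "\<epsilon> > 0"
      then have "\<forall>\<^sub>F n in sequentially. \<forall>i\<in>UNIV. \<forall>y\<in>ball x s.
          dist (\<Sum>k<n. D (e k) i y) (suminf (\<lambda>k. D (e k) i y)) < \<epsilon> / CARD('n)"
        using ul by (intro eventually_ball_finite) (auto simp: uniform_limit_iff)
      then show "\<forall>\<^sub>F n in sequentially. \<forall>y\<in>ball x s. \<forall>h.
          norm ((\<Sum>k<n. \<Sum>i\<in>UNIV. h $ i * D (e k) i y) - (\<Sum>i\<in>UNIV. h $ i * G i y)) \<le> \<epsilon> * norm h"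
      proof (eventually_elim, intro ballI allI)
        fix n y and h :: "real ^ 'n"
        assume *: "\<forall>i\<in>UNIV. \<forall>y\<in>ball x s.
          dist (\<Sum>k<n. D (e k) i y) (suminf (\<lambda>k. D (e k) i y)) < \<epsilon> / CARD('n)"
          and y: "y \<in> ball x s"
        have "(\<Sum>k<n. \<Sum>i\<in>UNIV. h $ i * D (e k) i y) - (\<Sum>i\<in>UNIV. h $ i * G i y)
           = (\<Sum>i\<in>UNIV. h $ i * ((\<Sum>k<n. D (e k) i y) - G i y))"
          by (subst sum.swap) (simp add: sum_subtractf right_diff_distrib sum_distrib_left)
        also have "norm \<dots> \<le> (\<Sum>i\<in>(UNIV :: 'n set). norm h * (\<epsilon> / CARD('n)))"
        proof (rule sum_norm_le)
          fix i
          have "\<bar>(\<Sum>k<n. D (e k) i y) - G i y\<bar> \<le> \<epsilon> / CARD('n)"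
            using *[rule_format, OF UNIV_I y, of i] unfolding GS[OF y] dist_real_def by simp
          then show "norm (h $ i * ((\<Sum>k<n. D (e k) i y) - G i y)) \<le> norm h * (\<epsilon> / CARD('n))"
            unfolding real_norm_def abs_mult using component_le_norm_cart[of h i]
            by (intro mult_mono) auto
        qed
        also have "\<dots> = \<epsilon> * norm h" by simp
        finally show "norm ((\<Sum>k<n. \<Sum>i\<in>UNIV. h $ i * D (e k) i y) - (\<Sum>i\<in>UNIV. h $ i * G i y)) \<le> \<epsilon> * norm h" .
      qed
    qed (use y in auto)
    then obtain g where g: "\<And>y. y \<in> ball x s \<Longrightarrow> (\<lambda>n. ?f n y) sums g y"
      "\<And>y. y \<in> ball x s \<Longrightarrow> (g has_derivative (\<lambda>h. \<Sum>i\<in>UNIV. h $ i * G i y)) (at y within ball x s)"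
      by blast
    \<comment> \<open>Termwise differentiation yields only some limit function \<open>g\<close>;
      uniqueness of sums identifies it with \<open>f\<close> on the ball.\<close>
    have eq: "f w = g w" if "w \<in> ball x s" for w
      using g(1)[OF that] sums[OF f[of w]] that s by (auto intro: sums_unique2)
    have "(f has_derivative (\<lambda>h. \<Sum>i\<in>UNIV. h $ i * G i y)) (at y within ball x s)"
      by (rule has_derivative_transform[OF y eq g(2)[OF y]])
    then show ?thesis by (simp only: at_within_open[OF y open_ball])
  qed
  have Gsum: "((\<lambda>\<alpha>. (real (\<alpha> i) + 1) * a (\<alpha>(i := \<alpha> i + 1)) * (\<Prod>j\<in>UNIV. (y $ j - x $ j) ^ \<alpha> j))
          has_sum G i y) UNIV" if y: "y \<in> ball x s" for i y
  proof -
    \<comment> \<open>\<open>?\<sigma>\<close> raises the \<open>i\<close>-th exponent by one. The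
      multi-indices it misses have exponent 0 there and their differentiated monomials vanish, so
      restricting the sum to its range loses nothing.\<close>
    let ?\<sigma> = "\<lambda>\<alpha>. \<alpha>(i := \<alpha> i + 1) :: 'n \<Rightarrow> nat"
    have inj: "inj ?\<sigma>"
    proof (rule injI)
      fix \<alpha> \<beta> assume "?\<sigma> \<alpha> = ?\<sigma> \<beta>"
      then have "\<alpha> j = \<beta> j" for j by (metis add_right_cancel fun_upd_apply)
      then show "\<alpha> = \<beta>" by blast
    qed
    have "D \<alpha> i y = 0" if "\<alpha> \<notin> range ?\<sigma>" for \<alpha>
    proof -
      have "\<alpha> i = 0"
      proof (rule ccontr)
        assume "\<alpha> i \<noteq> 0"
        then have "\<alpha> = ?\<sigma> (\<alpha>(i := \<alpha> i - 1))" by auto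
        with that show False by blast
      qed
      then show ?thesis by (simp add: D_def)
    qed
    then have "((\<lambda>\<alpha>. D \<alpha> i y) has_sum G i y) (range ?\<sigma>)"
      using DG[OF y, of i] by (subst has_sum_cong_neutral[where T = UNIV and g = "\<lambda>\<alpha>. D \<alpha> i y"]) auto
    then have "((\<lambda>\<alpha>. D (?\<sigma> \<alpha>) i y) has_sum G i y) UNIV"
      using has_sum_reindex[OF inj, of "\<lambda>\<alpha>. D \<alpha> i y"] by (simp add: o_def)
    moreover have "D (?\<sigma> \<alpha>) i y =
      (real (\<alpha> i) + 1) * a (?\<sigma> \<alpha>) * (\<Prod>j\<in>UNIV. (y $ j - x $ j) ^ \<alpha> j)" for \<alpha>
    proof -
      have "(\<Prod>j\<in>UNIV - {i}. (y $ j - x $ j) ^ ?\<sigma> \<alpha> j) = (\<Prod>j\<in>UNIV - {i}. (y $ j - x $ j) ^ \<alpha> j)"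
        by (rule prod.cong) auto
      then show ?thesis by (simp add: D_def prod.remove[of UNIV i] algebra_simps)
    qed
    ultimately show ?thesis by simp
  qed
  show ?thesis using s(1) fder Gsum by (intro exI[of _ s] exI[of _ G] conjI ballI allI)
qed

lemma partial_deriv_eq:
  fixes f :: "real ^ 'n \<Rightarrow> real"
  assumes "(f has_derivative (\<lambda>h. \<Sum>i\<in>UNIV. h $ i * G i)) (at y)"
  shows "partial_deriv i f y = G i"
proof -
  have "((\<lambda>s. f (y + s *\<^sub>R axis i 1)) has_derivative (\<lambda>s. \<Sum>j\<in>UNIV. (s *\<^sub>R axis i 1) $ j * G j)) (at 0)"
    by (rule has_derivative_compose[of "\<lambda>s. y + s *\<^sub>R axis i 1" "\<lambda>s. s *\<^sub>R axis i 1"])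
      (auto intro!: derivative_eq_intros simp: assms)
  moreover have "(\<Sum>j\<in>UNIV. (s *\<^sub>R axis i 1) $ j * G j) = G i * s" for s :: real
  proof -
    have "(\<Sum>j\<in>UNIV. (s *\<^sub>R axis i 1) $ j * G j) = (\<Sum>j\<in>UNIV. if j = i then s * G j else 0)"
      by (rule sum.cong) (auto simp: axis_def)
    then show ?thesis by simp
  qed
  ultimately have "((\<lambda>s. f (y + s *\<^sub>R axis i 1)) has_field_derivative G i) (at 0)"
    by (simp add: has_field_derivative_def)
  then show ?thesis unfolding partial_deriv_def by (rule DERIV_imp_deriv)
qed

text \<open>The total derivative determines the partial ones, so the functions \<open>G\<close> of
  the series lemma are the partial derivatives. The second part allows the first to be applied again
  to each of them; this is where the derivative of the gradient comes from.\<close>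

lemma real_analytic_partial_deriv:
  fixes f :: "real ^ 'n \<Rightarrow> real"
  assumes "real_analytic f"
  shows "(f has_derivative (\<lambda>h. \<Sum>i\<in>UNIV. h $ i * partial_deriv i f y)) (at y)"
    and "real_analytic (partial_deriv i f)"
proof -
  have *: "\<exists>s>0. (\<forall>y\<in>ball x s. (f has_derivative (\<lambda>h. \<Sum>i\<in>UNIV. h $ i * partial_deriv i f y)) (at y)) \<and>
    (\<forall>i. \<exists>b. \<forall>y\<in>ball x s. ((\<lambda>\<alpha>. b \<alpha> * (\<Prod>j\<in>UNIV. (y $ j - x $ j) ^ \<alpha> j))
          has_sum partial_deriv i f y) UNIV)" for x
  proof -
    obtain r and a :: "('n \<Rightarrow> nat) \<Rightarrow> real" where ra: "0 < r" "\<And>y. y \<in> ball x r \<Longrightarrow>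
        ((\<lambda>\<alpha>. a \<alpha> * (\<Prod>i\<in>UNIV. (y $ i - x $ i) ^ \<alpha> i)) has_sum f y) UNIV"
      using assms unfolding real_analytic_def by blast
    from power_series_has_derivative[OF ra] obtain s and G :: "'n \<Rightarrow> real ^ 'n \<Rightarrow> real"
      where s: "0 < s"
        and G: "\<forall>y\<in>ball x s. (f has_derivative (\<lambda>h. \<Sum>i\<in>UNIV. h $ i * G i y)) (at y) \<and>
          (\<forall>i. ((\<lambda>\<alpha>. (real (\<alpha> i) + 1) * a (\<alpha>(i := \<alpha> i + 1)) * (\<Prod>j\<in>UNIV. (y $ j - x $ j) ^ \<alpha> j))
            has_sum G i y) UNIV)" by blast
    have pd: "partial_deriv i f y = G i y" if "y \<in> ball x s" for i y
      using G that by (intro partial_deriv_eq) blast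
    show ?thesis
    proof (intro exI[of _ s] conjI s ballI allI)
      fix y assume "y \<in> ball x s"
      then show "(f has_derivative (\<lambda>h. \<Sum>i\<in>UNIV. h $ i * partial_deriv i f y)) (at y)"
        using G by (simp add: pd)
    next
      fix i
      show "\<exists>b. \<forall>y\<in>ball x s. ((\<lambda>\<alpha>. b \<alpha> * (\<Prod>j\<in>UNIV. (y $ j - x $ j) ^ \<alpha> j))
          has_sum partial_deriv i f y) UNIV"
        using G by (intro exI[of _ "\<lambda>\<alpha>. (real (\<alpha> i) + 1) * a (\<alpha>(i := \<alpha> i + 1))"]) (simp add: pd)
    qed
  qed
  show "(f has_derivative (\<lambda>h. \<Sum>i\<in>UNIV. h $ i * partial_deriv i f y)) (at y)"
    using *[of y] by force
  show "real_analytic (partial_deriv i f)"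
    unfolding real_analytic_def using * by blast
qed

section \<open>Gradients: local Lipschitz and Taylor estimates\<close>

definition grad :: "(real ^ 'n \<Rightarrow> real) \<Rightarrow> real ^ 'n \<Rightarrow> real ^ 'n" where
  "grad f x = (\<chi> i. partial_deriv i f x)"

lemma real_analytic_has_derivative_grad:
  assumes "real_analytic f"
  shows "(f has_derivative (\<lambda>h. h \<bullet> grad f x)) (at x)"
  using real_analytic_partial_deriv(1)[OF assms, of x] by (simp add: grad_def inner_vec_def)

lemma real_analytic_continuous_on:
  fixes f :: "real ^ 'n \<Rightarrow> real"
  assumes "real_analytic f"
  shows "continuous_on S f"
proof (rule has_derivative_continuous_on)
  show "(f has_derivative (\<lambda>h. h \<bullet> grad f x)) (at x within S)" for x
    using real_analytic_has_derivative_grad[OF assms] by (rule has_derivative_at_withinI)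
qed

lemma continuous_on_grad:
  fixes f :: "real ^ 'n \<Rightarrow> real"
  assumes "real_analytic f"
  shows "continuous_on S (grad f)"
proof -
  have "continuous_on S (\<lambda>x. \<chi> i. partial_deriv i f x)"
    using real_analytic_continuous_on[OF real_analytic_partial_deriv(2)[OF assms]]
    by (intro continuous_on_vec_lambda)
  then show ?thesis by (simp add: grad_def[abs_def])
qed

lemma real_analytic_lipschitz:
  fixes f :: "real ^ 'n \<Rightarrow> real"
  assumes "real_analytic f"
  shows "\<exists>L\<ge>0. \<forall>x\<in>cball 0 R. \<forall>y\<in>cball 0 R. \<bar>f x - f y\<bar> \<le> L * norm (x - y)"
proof -
  have "bounded (grad f ` cball 0 R)"
    by (intro compact_imp_bounded compact_continuous_image continuous_on_grad assms compact_cball)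
  then obtain L where L: "\<forall>z\<in>grad f ` cball 0 R. norm z \<le> L" by (auto simp: bounded_iff)
  \<comment> \<open>For negative \<open>R\<close> the ball is empty and \<open>L\<close> may be
    negative, hence \<open>max 0 L\<close>.\<close>
  have "norm (f x - f y) \<le> max 0 L * norm (x - y)" if "x \<in> cball 0 R" "y \<in> cball 0 R" for x y
  proof (rule differentiable_bound[where S = "cball 0 R" and f' = "\<lambda>x h. h \<bullet> grad f x"])
    fix z assume z: "z \<in> cball (0 :: real ^ 'n) R"
    show "(f has_derivative (\<lambda>h. h \<bullet> grad f z)) (at z within cball 0 R)"
      using real_analytic_has_derivative_grad[OF assms] by (rule has_derivative_at_withinI)
    show "onorm (\<lambda>h. h \<bullet> grad f z) \<le> max 0 L"
    proof (rule onorm_bound)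
      fix h
      have "norm (h \<bullet> grad f z) \<le> norm h * norm (grad f z)" by (simp add: Cauchy_Schwarz_ineq2)
      also have "\<dots> \<le> norm h * max 0 L" using L z by (intro mult_left_mono) (auto simp: le_max_iff_disj)
      finally show "norm (h \<bullet> grad f z) \<le> max 0 L * norm h" by (simp add: mult.commute)
    qed simp
  qed (use that in auto)
  then show ?thesis by (intro exI[of _ "max 0 L"]) auto
qed

lemma grad_lipschitz:
  fixes f :: "real ^ 'n \<Rightarrow> real"
  assumes "real_analytic f"
  shows "\<exists>L\<ge>0. \<forall>x\<in>cball 0 R. \<forall>y\<in>cball 0 R. norm (grad f x - grad f y) \<le> L * norm (x - y)"
proof -
  have "\<forall>i. \<exists>L\<ge>0. \<forall>x\<in>cball 0 R. \<forall>y\<in>cball 0 R. \<bar>partial_deriv i f x - partial_deriv i f y\<bar> \<le> L * norm (x - y)"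
    using real_analytic_lipschitz[OF real_analytic_partial_deriv(2)[OF assms]] by blast
  then obtain L where L: "\<And>i. L i \<ge> 0"
    "\<And>i x y. x \<in> cball 0 R \<Longrightarrow> y \<in> cball 0 R \<Longrightarrow> \<bar>partial_deriv i f x - partial_deriv i f y\<bar> \<le> L i * norm (x - y)"
    by metis
  have "norm (grad f x - grad f y) \<le> (\<Sum>i\<in>UNIV. L i) * norm (x - y)" if "x \<in> cball 0 R" "y \<in> cball 0 R" for x y
  proof -
    have "norm (grad f x - grad f y) \<le> (\<Sum>i\<in>UNIV. \<bar>(grad f x - grad f y) $ i\<bar>)" by (rule norm_le_l1_cart)
    also have "\<dots> \<le> (\<Sum>i\<in>UNIV. L i * norm (x - y))"
      using L(2)[OF that] by (intro sum_mono) (simp add: grad_def)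
    finally show ?thesis by (simp add: sum_distrib_right)
  qed
  then show ?thesis using L(1) by (intro exI[of _ "\<Sum>i\<in>UNIV. L i"]) (auto intro: sum_nonneg)
qed

text \<open>Along the segment from \<open>x\<close> to \<open>y\<close> the gradient differs from
  \<open>grad f x\<close> by at most \<open>L * norm (y - x)\<close>, and the mean value inequality
  turns this into a quadratic remainder. One constant serves a whole ball, as the first variation
  needs a bound uniform in time.\<close>

lemma real_analytic_taylor_bound:
  fixes f :: "real ^ 'n \<Rightarrow> real"
  assumes "real_analytic f"
  shows "\<exists>L\<ge>0. \<forall>x\<in>cball 0 R. \<forall>y\<in>cball 0 R. \<bar>f y - f x - (y - x) \<bullet> grad f x\<bar> \<le> L * (norm (y - x))\<^sup>2"
proof -
  obtain L where L: "L \<ge> 0" "\<forall>x\<in>cball 0 R. \<forall>y\<in>cball 0 R. norm (grad f x - grad f y) \<le> L * norm (x - y)"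
    using grad_lipschitz[OF assms] by blast
  have "norm (f y - f x - (y - x) \<bullet> grad f x) \<le> norm (y - x) * (L * norm (y - x))"
    if xy: "x \<in> cball 0 R" "y \<in> cball 0 R" for x y
  proof (rule differentiable_bound_linearization[where S = "closed_segment x y" and f' = "\<lambda>x h. h \<bullet> grad f x"])
    show "x + t *\<^sub>R (y - x) \<in> closed_segment x y" if "t \<in> {0..1}" for t
      using that by (auto simp: closed_segment_def algebra_simps intro!: exI[of _ t])
    show "x \<in> closed_segment x y" by simp
    fix z assume z: "z \<in> closed_segment x y"
    show "(f has_derivative (\<lambda>h. h \<bullet> grad f z)) (at z within closed_segment x y)"
      using real_analytic_has_derivative_grad[OF assms] by (rule has_derivative_at_withinI)
    have zR: "z \<in> cball 0 R"
      using closed_segment_subset[OF xy convex_cball] z by blast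
    have "norm (grad f z - grad f x) \<le> L * norm (z - x)" using L zR xy by blast
    also have "\<dots> \<le> L * norm (y - x)"
      using L(1) segment_bound(1)[OF z] by (intro mult_left_mono) (auto simp: norm_minus_commute)
    finally have *: "norm (grad f z - grad f x) \<le> L * norm (y - x)" .
    show "onorm ((\<lambda>h. h \<bullet> grad f z) - (\<lambda>h. h \<bullet> grad f x)) \<le> L * norm (y - x)"
    proof (rule onorm_bound)
      fix h
      have "norm (((\<lambda>h. h \<bullet> grad f z) - (\<lambda>h. h \<bullet> grad f x)) h) = \<bar>h \<bullet> (grad f z - grad f x)\<bar>"
        by (simp add: inner_diff_right)
      also have "\<dots> \<le> norm h * norm (grad f z - grad f x)" by (rule Cauchy_Schwarz_ineq2)
      also have "\<dots> \<le> norm h * (L * norm (y - x))" using * by (intro mult_left_mono) auto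
      finally show "norm (((\<lambda>h. h \<bullet> grad f z) - (\<lambda>h. h \<bullet> grad f x)) h) \<le> L * norm (y - x) * norm h"
        by (simp add: mult_ac)
    qed (use L(1) in simp)
  qed
  then show ?thesis using L(1) by (intro exI[of _ L]) (auto simp: power2_eq_square mult_ac)
qed

section \<open>Second derivatives and bounds near a nondegenerate zero\<close>

lemma grad_has_derivative:
  fixes f :: "real ^ 'n \<Rightarrow> real"
  assumes "real_analytic f"
  shows "(grad f has_derivative (\<lambda>h. \<chi> j. \<Sum>i\<in>UNIV. h $ i * hessian f x $ i $ j)) (at x)"
proof -
  have "((\<lambda>x. grad f x $ j) has_derivative (\<lambda>h. \<Sum>i\<in>UNIV. h $ i * hessian f x $ i $ j)) (at x)" for j
    using real_analytic_partial_deriv(1)[OF real_analytic_partial_deriv(2)[OF assms]]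
    by (simp add: grad_def hessian_def)
  then show ?thesis
    by (subst has_derivative_componentwise_within) (auto simp: Basis_vec_def inner_axis)
qed

text \<open>The minimum of the quadratic form over the compact unit sphere is attained at some
  \<open>w\<close>, hence positive, and homogeneity spreads it to all vectors.\<close>

lemma positive_definite_coercive:
  fixes A :: "real ^ 'n ^ 'n"
  assumes "positive_definite A"
  obtains c where "c > 0" "\<forall>v. c * (norm v)\<^sup>2 \<le> v \<bullet> (A *v v)"
proof -
  have cont: "continuous_on (sphere 0 1) (\<lambda>v. v \<bullet> (A *v v))"
    by (intro continuous_intros matrix_vector_mult_linear_continuous_on)
  have "(axis undefined 1 :: real ^ 'n) \<in> sphere 0 1" by (simp add: norm_axis_1)
  then obtain w where w: "w \<in> sphere 0 1" "\<forall>v\<in>sphere 0 1. w \<bullet> (A *v w) \<le> v \<bullet> (A *v v)"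
    using continuous_attains_inf[OF compact_sphere _ cont] by blast
  show thesis
  proof (rule that[of "w \<bullet> (A *v w)"])
    have "w \<noteq> 0" using w(1) by auto
    then show "w \<bullet> (A *v w) > 0" using assms by (simp add: positive_definite_def)
    show "\<forall>v. w \<bullet> (A *v w) * (norm v)\<^sup>2 \<le> v \<bullet> (A *v v)"
    proof
      fix v :: "real ^ 'n"
      show "w \<bullet> (A *v w) * (norm v)\<^sup>2 \<le> v \<bullet> (A *v v)"
      proof (cases "v = 0")
        case False
        define n where "n = v /\<^sub>R norm v"
        have "n \<in> sphere 0 1" using False by (simp add: n_def)
        then have "w \<bullet> (A *v w) * (norm v)\<^sup>2 \<le> n \<bullet> (A *v n) * (norm v)\<^sup>2"
          using w(2) by (intro mult_right_mono) auto
        also have "\<dots> = (norm v *\<^sub>R n) \<bullet> (A *v (norm v *\<^sub>R n))"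
          by (simp add: matrix_vector_mult_scaleR power2_eq_square)
        also have "norm v *\<^sub>R n = v" using False by (simp add: n_def)
        finally show ?thesis .
      qed simp
    qed
  qed
qed

text \<open>A zero of a nonnegative function is a minimum, so the gradient vanishes at
  \<open>p\<close>. Near \<open>p\<close> the gradient is linear in \<open>y - p\<close> up to an
  error of at most half the coercivity constant times \<open>norm (y - p)\<close>; the other half
  survives in the lower bound. The upper bound is the Taylor estimate with vanishing first-order
  term.\<close>

lemma nondegenerate_zero_bounds:
  fixes f :: "real ^ 'n \<Rightarrow> real"
  assumes f: "real_analytic f" and nonneg: "\<And>x. 0 \<le> f x" and p: "f p = 0"
    and pd: "positive_definite (hessian f p)"
  shows "\<exists>c>0. \<exists>C>0. \<exists>r>0. \<forall>y. norm (y - p) < r \<longrightarrow>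
      c * (norm (y - p))\<^sup>2 \<le> (y - p) \<bullet> grad f y \<and> f y \<le> C * (norm (y - p))\<^sup>2"
proof -
  have "(\<lambda>h. h \<bullet> grad f p) = (\<lambda>h. 0)"
    using nonneg p by (intro differential_zero_maxmin[OF UNIV_I open_UNIV real_analytic_has_derivative_grad[OF f]]) auto
  then have g0: "grad f p = 0" by (metis inner_eq_zero_iff)
  obtain c where c: "c > 0" "\<forall>v. c * (norm v)\<^sup>2 \<le> v \<bullet> (hessian f p *v v)"
    using positive_definite_coercive[OF pd] by metis
  \<comment> \<open>The row index of \<open>hessian\<close> is the outer derivative, so
    \<open>?A\<close> is the transposed Hessian; the quadratic form does not see the
    transposition.\<close>
  let ?A = "\<lambda>h. \<chi> j. \<Sum>i\<in>UNIV. h $ i * hessian f p $ i $ j"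
  have A: "h \<bullet> ?A h = h \<bullet> (hessian f p *v h)" for h
  proof -
    have "h \<bullet> ?A h = (\<Sum>j\<in>UNIV. \<Sum>i\<in>UNIV. h $ j * (h $ i * hessian f p $ i $ j))"
      by (simp add: inner_vec_def sum_distrib_left)
    also have "\<dots> = (\<Sum>i\<in>UNIV. \<Sum>j\<in>UNIV. h $ j * (h $ i * hessian f p $ i $ j))" by (rule sum.swap)
    also have "\<dots> = h \<bullet> (hessian f p *v h)"
      by (simp add: inner_vec_def matrix_vector_mult_def sum_distrib_left mult_ac)
    finally show ?thesis .
  qed
  have "0 < c / 2" using c(1) by simp
  then obtain r where r: "r > 0" "\<forall>y. norm (y - p) < r \<longrightarrow> norm (grad f y - grad f p - ?A (y - p)) \<le> c / 2 * norm (y - p)"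
    using grad_has_derivative[OF f, of p] unfolding has_derivative_at_alt by blast
  obtain L where L: "L \<ge> 0" "\<forall>x\<in>cball 0 (norm p + 1). \<forall>y\<in>cball 0 (norm p + 1).
      \<bar>f y - f x - (y - x) \<bullet> grad f x\<bar> \<le> L * (norm (y - x))\<^sup>2"
    using real_analytic_taylor_bound[OF f] by blast
  \<comment> \<open>The radius is capped at 1 so that \<open>y\<close> stays in the ball of the
    Taylor bound; \<open>L + 1\<close> is positive even when \<open>L\<close> is 0.\<close>
  have "c / 2 * (norm (y - p))\<^sup>2 \<le> (y - p) \<bullet> grad f y \<and> f y \<le> (L + 1) * (norm (y - p))\<^sup>2"
    if y: "norm (y - p) < min r 1" for y
  proof
    let ?h = "y - p"
    have "\<bar>?h \<bullet> (grad f y - ?A ?h)\<bar> \<le> norm ?h * norm (grad f y - ?A ?h)" by (rule Cauchy_Schwarz_ineq2)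
    also have "\<dots> \<le> norm ?h * (c / 2 * norm ?h)" using r(2) y g0 by (intro mult_left_mono) auto
    finally have 1: "\<bar>?h \<bullet> grad f y - ?h \<bullet> ?A ?h\<bar> \<le> c / 2 * (norm ?h)\<^sup>2"
      by (simp add: inner_diff_right power2_eq_square mult_ac)
    have 2: "c * (norm ?h)\<^sup>2 \<le> ?h \<bullet> ?A ?h" unfolding A using c(2) by blast
    have 3: "c / 2 * N \<le> X" if "\<bar>X - Y\<bar> \<le> c / 2 * N" "c * N \<le> Y" for N X Y :: real
    proof -
      have "Y - X \<le> \<bar>X - Y\<bar>" "c / 2 * N = c * N / 2" by auto
      with that show ?thesis by linarith
    qed
    show "c / 2 * (norm ?h)\<^sup>2 \<le> ?h \<bullet> grad f y" by (rule 3[OF 1 2])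
    have "norm y \<le> norm p + 1" using y norm_triangle_sub[of y p] by simp
    then have "\<bar>f y - f p - ?h \<bullet> grad f p\<bar> \<le> L * (norm ?h)\<^sup>2"
      using L(2) by simp
    then have "f y \<le> L * (norm ?h)\<^sup>2" using p g0 by simp
    also have "\<dots> \<le> (L + 1) * (norm ?h)\<^sup>2" by (intro mult_right_mono) auto
    finally show "f y \<le> (L + 1) * (norm ?h)\<^sup>2" .
  qed
  then show ?thesis using c(1) r(1) L(1)
    by (intro exI[of _ "c / 2"] exI[of _ "L + 1"] exI[of _ "min r 1"] conjI) auto
qed


section \<open>The calculus of variations lemmas on the half line\<close>

lemma borel_measurable_lebesgue_continuous:
  fixes f :: "real \<Rightarrow> 'b::real_normed_vector"
  assumes "continuous_on UNIV f"
  shows "f \<in> borel_measurable lebesgue"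
  using assms by (intro measurable_completion) (auto intro: borel_measurable_continuous_onI)

lemma test_function_onI:
  assumes "\<And>t. (\<eta> has_real_derivative \<eta>' t) (at t)" "continuous_on UNIV \<eta>'"
    and "{a..b} \<subseteq> S" "\<And>t. t \<notin> {a..b} \<Longrightarrow> \<eta> t = 0"
  shows "test_function_on S \<eta>" and "deriv \<eta> = \<eta>'"
proof -
  show d: "deriv \<eta> = \<eta>'" using assms(1) by (auto intro: DERIV_imp_deriv)
  have "\<eta> differentiable_on UNIV"
    unfolding differentiable_on_def real_differentiable_def
    using assms(1) by (blast intro: has_field_derivative_at_within)
  then show "test_function_on S \<eta>"
    unfolding test_function_on_def d using assms(2-4) by blast
qed

lemma test_function_on_DERIV:
  assumes "test_function_on S \<eta>"
  shows "(\<eta> has_real_derivative deriv \<eta> t) (at t)"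
  using assms unfolding test_function_on_def differentiable_on_def
  by (auto simp: DERIV_deriv_iff_real_differentiable)

lemma test_function_on_continuous:
  assumes "test_function_on S \<eta>"
  shows "continuous_on A \<eta>" "continuous_on A (deriv \<eta>)"
proof -
  show "continuous_on A \<eta>"
    using test_function_on_DERIV[OF assms] by (blast intro: DERIV_continuous_on has_field_derivative_at_within)
  show "continuous_on A (deriv \<eta>)"
    using assms continuous_on_subset unfolding test_function_on_def by blast
qed

lemma test_function_on_vanishes:
  assumes "test_function_on S \<eta>"
  obtains K where "compact K" "K \<subseteq> S" "\<forall>t. t \<notin> K \<longrightarrow> \<eta> t = 0 \<and> deriv \<eta> t = 0"
proof -
  obtain K where K: "compact K" "K \<subseteq> S" "\<And>t. t \<notin> K \<Longrightarrow> \<eta> t = 0"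
    using assms unfolding test_function_on_def by blast
  have "deriv \<eta> t = 0" if "t \<notin> K" for t
  proof -
    have "(\<eta> has_field_derivative 0) (at t)"
    proof (rule has_field_derivative_transform_within_open[where f = "\<lambda>_. 0" and S = "- K"])
      show "open (- K)" using K(1) by (simp add: compact_imp_closed open_Compl)
    qed (use that K(3) in auto)
    then show ?thesis by (rule DERIV_imp_deriv)
  qed
  with K that show thesis by blast
qed

lemma test_function_on_support:
  assumes "test_function_on {0<..} \<eta>"
  obtains a b where "0 < a" "a < b" "\<forall>t. t \<notin> {a<..<b} \<longrightarrow> \<eta> t = 0 \<and> deriv \<eta> t = 0"
proof -
  obtain K where K: "compact K" "K \<subseteq> {0<..}" "\<forall>t. t \<notin> K \<longrightarrow> \<eta> t = 0 \<and> deriv \<eta> t = 0"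
    using test_function_on_vanishes[OF assms] by metis
  show thesis
  proof (cases "K = {}")
    case True
    show thesis by (rule that[of 1 2]) (use True K(3) in auto)
  next
    case False
    obtain m where m: "m \<in> K" "\<And>t. t \<in> K \<Longrightarrow> m \<le> t"
      using compact_attains_inf[OF K(1) False] by blast
    obtain M where M: "M \<in> K" "\<And>t. t \<in> K \<Longrightarrow> t \<le> M"
      using compact_attains_sup[OF K(1) False] by blast
    have "0 < m" using m(1) K(2) by auto
    \<comment> \<open>\<open>m / 2\<close> and \<open>M + 1\<close> leave room on both sides of the
      support, so the open interval contains it and its left end stays positive.\<close>
    have *: "t \<notin> K" if "t \<notin> {m/2<..<M+1}" for t
      using m(2)[of t] M(2)[of t] that \<open>0 < m\<close> by auto
    show thesis by (rule that[of "m / 2" "M + 1"]) (use m(2)[OF M(1)] \<open>0 < m\<close> * K(3) in auto)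
  qed
qed

text \<open>Integrability is required up to the endpoint \<open>0\<close>.\<close>

definition locally_integrable :: "(real \<Rightarrow> 'b::euclidean_space) \<Rightarrow> bool" where
  "locally_integrable f \<longleftrightarrow> (\<forall>T>0. set_integrable lebesgue {0<..<T} f)"

lemma set_integrable_continuous_scaleR:
  fixes f :: "real \<Rightarrow> 'b::euclidean_space" and \<eta> :: "real \<Rightarrow> real"
  assumes f: "set_integrable lebesgue {a..b} f" and \<eta>: "continuous_on UNIV \<eta>"
  shows "set_integrable lebesgue {a..b} (\<lambda>t. \<eta> t *\<^sub>R f t)"
proof -
  have "bounded (\<eta> ` {a..b})"
    using \<eta> by (intro compact_imp_bounded compact_continuous_image) (auto intro: continuous_on_subset)
  moreover have "\<eta> \<in> borel_measurable (lebesgue_on {a..b})"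
    using borel_measurable_lebesgue_continuous[OF \<eta>] by (rule measurable_restrict_space1)
  ultimately show ?thesis
    using absolutely_integrable_bounded_measurable_product[of "(*\<^sub>R)" \<eta> "{a..b}" f] f
    by (simp add: bilinear_conv_bounded_bilinear bounded_bilinear_scaleR)
qed

lemma locally_integrableD:
  assumes "locally_integrable f" "0 < a"
  shows "set_integrable lebesgue {a..b} f"
proof -
  \<comment> \<open>\<open>max 0 b + 1\<close> is a positive bound beyond \<open>b\<close>, whatever
    the sign of \<open>b\<close>.\<close>
  have "set_integrable lebesgue {0<..<max 0 b + 1} f"
    using assms(1) by (auto simp: locally_integrable_def)
  then show ?thesis by (rule set_integrable_subset) (use assms(2) in auto)
qed

lemma set_integrable_restrict_support:
  assumes "A \<subseteq> S" "\<And>t. t \<in> S - A \<Longrightarrow> g t = 0"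
  shows "set_integrable M S g \<longleftrightarrow> set_integrable M A g" "(LINT t:S|M. g t) = (LINT t:A|M. g t)"
proof -
  have "(\<lambda>t. indicator S t *\<^sub>R g t) = (\<lambda>t. indicator A t *\<^sub>R g t)"
    using assms by (auto simp: fun_eq_iff indicator_def)
  then show "set_integrable M S g \<longleftrightarrow> set_integrable M A g" "(LINT t:S|M. g t) = (LINT t:A|M. g t)"
    unfolding set_integrable_def set_lebesgue_integral_def by simp_all
qed

lemma compact_support_integrable:
  fixes f :: "real \<Rightarrow> 'b::euclidean_space" and \<eta> :: "real \<Rightarrow> real"
  assumes "locally_integrable f" "continuous_on UNIV \<eta>" "0 < a" "\<And>t. t \<notin> {a<..<b} \<Longrightarrow> \<eta> t = 0"
  shows "set_integrable lebesgue {0<..} (\<lambda>t. \<eta> t *\<^sub>R f t)"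
proof -
  have *: "{a..b} \<subseteq> {0<..}" "\<And>t. t \<in> {0<..} - {a..b} \<Longrightarrow> \<eta> t *\<^sub>R f t = 0"
    using assms(3,4) by auto
  have "set_integrable lebesgue {a..b} (\<lambda>t. \<eta> t *\<^sub>R f t)"
    by (intro set_integrable_continuous_scaleR locally_integrableD assms)
  then show ?thesis
    using set_integrable_restrict_support(1)[OF *] by simp
qed

lemma test_function_integrable:
  fixes f :: "real \<Rightarrow> 'b::euclidean_space"
  assumes "locally_integrable f" "test_function_on {0<..} \<eta>"
  shows "set_integrable lebesgue {0<..} (\<lambda>t. \<eta> t *\<^sub>R f t)"
    and "set_integrable lebesgue {0<..} (\<lambda>t. deriv \<eta> t *\<^sub>R f t)"
proof -
  obtain a b where "0 < a" "\<forall>t. t \<notin> {a<..<b} \<longrightarrow> \<eta> t = 0 \<and> deriv \<eta> t = 0"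
    using test_function_on_support[OF assms(2)] by metis
  then show "set_integrable lebesgue {0<..} (\<lambda>t. \<eta> t *\<^sub>R f t)"
    "set_integrable lebesgue {0<..} (\<lambda>t. deriv \<eta> t *\<^sub>R f t)"
    using compact_support_integrable[OF assms(1)] test_function_on_continuous[OF assms(2)] by blast+
qed

lemma locally_integrable_continuous:
  fixes f :: "real \<Rightarrow> 'b::euclidean_space"
  assumes "continuous_on {0..} f"
  shows "locally_integrable f"
  unfolding locally_integrable_def
proof (intro allI impI)
  fix T :: real
  have "continuous_on {0..T} f" using assms by (rule continuous_on_subset) auto
  then have "set_integrable lebesgue {0..T} f" by (rule absolutely_integrable_continuous_real)
  then show "set_integrable lebesgue {0<..<T} f" by (rule set_integrable_subset) auto
qed

text \<open>Integrating the derivative of the product \<eta> F over an interval that contains the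
  support leaves no boundary terms; thus a classical derivative is a weak one.\<close>

lemma integral_deriv_scaleR:
  fixes F G :: "real \<Rightarrow> 'b::euclidean_space"
  assumes \<eta>: "test_function_on {0<..} \<eta>"
    and F: "\<And>t. 0 < t \<Longrightarrow> (F has_vector_derivative G t) (at t)"
    and G: "continuous_on {0<..} G"
  shows "(LINT t:{0<..}|lebesgue. deriv \<eta> t *\<^sub>R F t) = - (LINT t:{0<..}|lebesgue. \<eta> t *\<^sub>R G t)"
proof -
  obtain a b where ab: "0 < a" "a < b" and "\<forall>t. t \<notin> {a<..<b} \<longrightarrow> \<eta> t = 0 \<and> deriv \<eta> t = 0"
    using test_function_on_support[OF \<eta>] by metis
  then have z: "\<eta> t = 0" "deriv \<eta> t = 0" if "t \<notin> {a<..<b}" for t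
    using that by metis+
  have cF: "continuous_on {a..b} F"
  proof (rule continuous_on_vector_derivative)
    fix t assume "t \<in> {a..b}"
    then show "(F has_vector_derivative G t) (at t within {a..b})"
      using F[of t] ab by (auto intro: has_vector_derivative_at_within)
  qed
  have cG: "continuous_on {a..b} G" using G by (rule continuous_on_subset) (use ab in auto)
  have i1: "set_integrable lebesgue {a..b} (\<lambda>t. deriv \<eta> t *\<^sub>R F t)"
    and i2: "set_integrable lebesgue {a..b} (\<lambda>t. \<eta> t *\<^sub>R G t)"
    using cF cG by (auto intro!: absolutely_integrable_continuous_real continuous_intros test_function_on_continuous[OF \<eta>])
  have "((\<lambda>t. deriv \<eta> t *\<^sub>R F t + \<eta> t *\<^sub>R G t) has_integral \<eta> b *\<^sub>R F b - \<eta> a *\<^sub>R F a) {a..b}"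
  proof (rule fundamental_theorem_of_calculus)
    fix t assume "t \<in> {a..b}"
    then show "((\<lambda>t. \<eta> t *\<^sub>R F t) has_vector_derivative deriv \<eta> t *\<^sub>R F t + \<eta> t *\<^sub>R G t) (at t within {a..b})"
      using has_vector_derivative_scaleR[OF has_field_derivative_at_within[OF test_function_on_DERIV[OF \<eta>]]
        has_vector_derivative_at_within[OF F]] ab
      by (auto simp: add.commute)
  qed (use ab in simp)
  then have "integral {a..b} (\<lambda>t. deriv \<eta> t *\<^sub>R F t + \<eta> t *\<^sub>R G t) = 0"
    using z(1)[of a] z(1)[of b] by (simp add: integral_unique)
  then have "(LINT t:{a..b}|lebesgue. deriv \<eta> t *\<^sub>R F t) + (LINT t:{a..b}|lebesgue. \<eta> t *\<^sub>R G t) = 0"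
    using set_lebesgue_integral_eq_integral[OF i1] set_lebesgue_integral_eq_integral[OF i2]
    by (simp add: integral_add)
  moreover have "(LINT t:{0<..}|lebesgue. deriv \<eta> t *\<^sub>R F t) = (LINT t:{a..b}|lebesgue. deriv \<eta> t *\<^sub>R F t)"
    "(LINT t:{0<..}|lebesgue. \<eta> t *\<^sub>R G t) = (LINT t:{a..b}|lebesgue. \<eta> t *\<^sub>R G t)"
    using ab z by (auto intro!: set_integrable_restrict_support(2))
  ultimately show ?thesis by (simp add: eq_neg_iff_add_eq_0)
qed

section \<open>Continuously differentiable bump functions\<close>

lemma DERIV_max_zero_square:
  "((\<lambda>x. (max 0 x)\<^sup>2) has_real_derivative 2 * max 0 x) (at (x::real))"
proof (cases "x = 0")
  case False
  then consider "x > 0" | "x < 0" by linarith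
  then show ?thesis
  proof cases
    case 1
    have "((\<lambda>x. x\<^sup>2) has_real_derivative 2 * x) (at x)" by (auto intro!: derivative_eq_intros)
    then have "((\<lambda>x. (max 0 x)\<^sup>2) has_real_derivative 2 * x) (at x)"
      by (rule has_field_derivative_transform_within_open[where S = "{0<..}"]) (use 1 in auto)
    then show ?thesis using 1 by simp
  next
    case 2
    have "((\<lambda>x. 0) has_real_derivative 0) (at x)" by simp
    then have "((\<lambda>x. (max 0 x)\<^sup>2) has_real_derivative 0) (at x)"
      by (rule has_field_derivative_transform_within_open[where S = "{..<0}"]) (use 2 in auto)
    then show ?thesis using 2 by simp
  qed
next
  case True
  \<comment> \<open>At 0 the difference quotient of the squared positive part is
    \<open>max 0 h\<close> itself, which tends to 0: squaring removes the kink.\<close>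
  have "((\<lambda>h. max 0 h :: real) \<longlongrightarrow> 0) (at 0)"
    using tendsto_max[OF tendsto_const[of 0] tendsto_ident_at[of "0 :: real" UNIV]] by simp
  then have "((\<lambda>h. (max 0 h)\<^sup>2 / h :: real) \<longlongrightarrow> 0) (at 0)"
    by (rule filterlim_mono_eventually) (auto simp: max_def power2_eq_square eventually_at_filter)
  then show ?thesis by (simp add: True DERIV_def)
qed

text \<open>With \<open>p\<close> the squared positive part of (t - a)(b - t), the quotients k p /
  (1 + k p) are continuously differentiable, lie between 0 and 1, vanish where \<open>p\<close> does
  and tend to 1 where \<open>p\<close> is positive. They approximate the indicator of the open
  interval; their strict positivity serves to build a test function with nonzero integral.\<close>

lemma bump_functions:
  fixes a b :: real
  assumes "a < b"
  obtains \<eta> :: "nat \<Rightarrow> real \<Rightarrow> real"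
  where "\<forall>S k. {a..b} \<subseteq> S \<longrightarrow> test_function_on S (\<eta> k)"
    and "\<forall>k t. 0 \<le> \<eta> k t \<and> \<eta> k t \<le> 1" and "\<forall>k t. t \<notin> {a<..<b} \<longrightarrow> \<eta> k t = 0"
    and "\<forall>t\<in>{a<..<b}. (\<lambda>k. \<eta> k t) \<longlonglongrightarrow> 1" and "\<forall>k>0. \<forall>t\<in>{a<..<b}. 0 < \<eta> k t"
proof -
  define p where "p t = (max 0 ((t - a) * (b - t)))\<^sup>2" for t
  define p' where "p' t = 2 * max 0 ((t - a) * (b - t)) * (a + b - 2 * t)" for t
  have p: "(p has_real_derivative p' t) (at t)" for t
  proof -
    have "((\<lambda>t. (t - a) * (b - t)) has_real_derivative (a + b - 2 * t)) (at t)"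
      by (auto intro!: derivative_eq_intros)
    from DERIV_chain2[OF DERIV_max_zero_square this] show ?thesis
      by (simp add: p_def[abs_def] p'_def)
  qed
  have p0: "0 \<le> p t" for t by (simp add: p_def)
  have ppos: "0 < p t" if "t \<in> {a<..<b}" for t using that by (simp add: p_def)
  have pz: "p t = 0" if "t \<notin> {a<..<b}" for t
  proof -
    have "(t - a) * (b - t) \<le> 0" using that assms by (auto simp: mult_le_0_iff)
    then show ?thesis by (simp add: p_def)
  qed
  define \<eta> where "\<eta> k t = real k * p t / (1 + real k * p t)" for k t
  have den: "1 + real k * p t > 0" for k t using p0[of t] by (simp add: add_pos_nonneg)
  have cp: "continuous_on UNIV p" using p by (intro DERIV_continuous_on) auto
  show thesis
  proof (rule that[of \<eta>]; intro allI impI ballI)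
    fix S :: "real set" and k :: nat assume S: "{a..b} \<subseteq> S"
    show "test_function_on S (\<eta> k)"
    proof (rule test_function_onI(1)[OF _ _ S])
      have 1: "((\<lambda>t. real k * p t) has_real_derivative real k * p' t) (at t)" for t
        by (rule DERIV_cmult[OF p])
      have 2: "((\<lambda>t. 1 + real k * p t) has_real_derivative 0 + real k * p' t) (at t)" for t
        by (rule DERIV_add[OF DERIV_const 1])
      show "(\<eta> k has_real_derivative (real k * p' t * (1 + real k * p t) - real k * p t * (0 + real k * p' t))
          / ((1 + real k * p t) * (1 + real k * p t))) (at t)" for t
        unfolding \<eta>_def[abs_def] using den[of k t] by (intro DERIV_divide 1 2) simp
      have "(1 + real k * p t) * (1 + real k * p t) \<noteq> 0" for t using den[of k t] by simp
      moreover have "continuous_on UNIV p'" unfolding p'_def by (intro continuous_intros)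
      ultimately show "continuous_on UNIV (\<lambda>t. (real k * p' t * (1 + real k * p t) - real k * p t * (0 + real k * p' t))
          / ((1 + real k * p t) * (1 + real k * p t)))"
        using cp by (intro continuous_on_divide continuous_on_mult continuous_on_add continuous_on_diff
            continuous_on_const ballI)
      show "t \<notin> {a..b} \<Longrightarrow> \<eta> k t = 0" for t using pz[of t] by (auto simp: \<eta>_def)
    qed
  next
    fix k t show "0 \<le> \<eta> k t \<and> \<eta> k t \<le> 1" using p0[of t] den[of k t] by (simp add: \<eta>_def)
  next
    fix k t assume "t \<notin> {a<..<b}" then show "\<eta> k t = 0" using pz[of t] by (simp add: \<eta>_def)
  next
    fix t assume "t \<in> {a<..<b}"
    from ppos[OF this] have "filterlim (\<lambda>k. 1 + real k * p t) at_top sequentially"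
      by (intro filterlim_tendsto_add_at_top[OF tendsto_const]
          filterlim_at_top_mult_tendsto_pos[OF tendsto_const] filterlim_real_sequentially)
    then have "(\<lambda>k. 1 / (1 + real k * p t)) \<longlonglongrightarrow> 0"
      by (intro real_tendsto_divide_at_top[OF tendsto_const])
    from tendsto_diff[OF tendsto_const[of 1] this] have "(\<lambda>k. 1 - 1 / (1 + real k * p t)) \<longlonglongrightarrow> 1" by simp
    moreover have "1 - 1 / (1 + real k * p t) = \<eta> k t" for k
      using den[of k t] by (simp add: \<eta>_def field_simps)
    ultimately show "(\<lambda>k. \<eta> k t) \<longlonglongrightarrow> 1" by simp
  next
    fix k :: nat and t assume "k > 0" "t \<in> {a<..<b}"
    then show "0 < \<eta> k t" using ppos[of t] den[of k t] by (simp add: \<eta>_def)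
  qed
qed

section \<open>The fundamental lemma of the calculus of variations\<close>

lemma sigma_finite_lebesgue: "sigma_finite_measure (lebesgue :: 'a::euclidean_space measure)"
proof
  obtain A :: "'a set set" where "countable A" "A \<subseteq> sets lborel" "\<Union> A = space lborel"
    "\<forall>a\<in>A. emeasure lborel a \<noteq> \<infinity>"
    using lborel.sigma_finite_countable by blast
  then show "\<exists>A. countable A \<and> A \<subseteq> sets lebesgue \<and> \<Union> A = space (lebesgue :: 'a measure) \<and>
      (\<forall>a\<in>A. emeasure lebesgue a \<noteq> \<infinity>)"
    by (intro exI[of _ A]) (auto simp: subset_iff)
qed

text \<open>Closed intervals generate the Borel sets, so induction carries the vanishing of
  integrals to all of these; \<open>tot\<close> serves the complements. A Lebesgue set differs from
  a Borel set by a null set, and a function whose averages all lie in the closed set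
  \<open>{0}\<close> is 0 almost everywhere.\<close>

lemma AE_zero_if_interval_integrals_zero:
  fixes f :: "real \<Rightarrow> 'b::euclidean_space"
  assumes f: "integrable lebesgue f" and tot: "(LINT t|lebesgue. f t) = 0"
    and ab: "\<And>a b. (LINT t:{a..b}|lebesgue. f t) = 0"
  shows "AE t in lebesgue. f t = 0"
proof -
  have si: "set_integrable lebesgue A f" if "A \<in> sets lebesgue" for A
    using f that unfolding set_integrable_def by (rule integrable_mult_indicator[rotated])
  have borel: "(LINT t:A|lebesgue. f t) = 0" if "A \<in> sets borel" for A
    using that
  proof (induction rule: borel_set_induct)
    case empty then show ?case by (simp add: set_lebesgue_integral_def)
  next
    case (interval a b) show ?case by (rule ab)
  next
    case (compl A)
    then have "(LINT t:A \<union> - A|lebesgue. f t) = (LINT t:A|lebesgue. f t) + (LINT t:- A|lebesgue. f t)"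
      by (intro set_integral_Un si) auto
    with compl tot show ?case by (simp add: set_lebesgue_integral_def)
  next
    case (union A)
    have "(LINT t:(\<Union>i. A i)|lebesgue. f t) = (\<Sum>i. LINT t:A i|lebesgue. f t)"
      using union by (intro lebesgue_integral_countable_add si) (auto simp: disjoint_family_on_def)
    with union show ?case by simp
  qed
  have "(LINT t:A|lebesgue. f t) = 0" if "A \<in> sets lebesgue" for A
  proof -
    from that obtain S N N' where A: "A = S \<union> N" "N \<subseteq> N'" "N' \<in> null_sets lborel" "S \<in> sets borel"
      by (auto elim: sets_completionE)
    have "AE t in lebesgue. t \<notin> N'"
      using A(3) by (intro AE_not_in null_sets_completionI)
    then have "AE t in lebesgue. t \<in> S \<longleftrightarrow> t \<in> A"
      by eventually_elim (use A in auto)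
    moreover have "S \<in> sets lebesgue" using A(4) by auto
    ultimately have "(LINT t:A|lebesgue. f t) = (LINT t:S|lebesgue. f t)"
      using si that by (intro set_integral_cong_set) (auto simp: set_integrable_def set_borel_measurable_def)
    with borel[OF A(4)] show ?thesis by simp
  qed
  then have "AE t in lebesgue. f t \<in> {0}"
    by (intro sigma_finite_measure.averaging_theorem[OF _ f] closed_singleton)
      (use sigma_finite_lebesgue in auto)
  then show ?thesis by simp
qed

text \<open>Testing with bumps that tend to the indicator of an interval, dominated by the norm of
  \<open>f\<close>, shows that \<open>f\<close> has zero integral over every compact interval in the
  open half line. Truncation to such an interval makes \<open>f\<close> integrable on the whole
  line, and countably many of them cover the half line.\<close>

lemma fundamental_lemma_calculus_of_variations:
  fixes f :: "real \<Rightarrow> 'b::euclidean_space"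
  assumes f: "locally_integrable f"
    and 0: "\<And>\<eta>. test_function_on {0<..} \<eta> \<Longrightarrow> (LINT t:{0<..}|lebesgue. \<eta> t *\<^sub>R f t) = 0"
  shows "AE t in lebesgue. 0 < t \<longrightarrow> f t = 0"
proof -
  have ab: "(LINT t:{a..b}|lebesgue. f t) = 0" if "0 < a" for a b
  proof (cases "a < b")
    case True
    obtain \<eta> :: "nat \<Rightarrow> real \<Rightarrow> real" where
      T: "\<forall>S k. {a..b} \<subseteq> S \<longrightarrow> test_function_on S (\<eta> k)"
      and le: "\<forall>k t. 0 \<le> \<eta> k t \<and> \<eta> k t \<le> 1" and z: "\<forall>k t. t \<notin> {a<..<b} \<longrightarrow> \<eta> k t = 0"
      and lim: "\<forall>t\<in>{a<..<b}. (\<lambda>k. \<eta> k t) \<longlonglongrightarrow> 1"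
      using bump_functions[OF True] by metis
    have T: "test_function_on {0<..} (\<eta> k)" for k by (rule T[rule_format]) (use that in auto)
    have int: "set_integrable lebesgue {a<..<b} f"
      using locally_integrableD[OF f that, of b] by (rule set_integrable_subset) auto
    have "(\<lambda>k. LINT t:{a<..<b}|lebesgue. \<eta> k t *\<^sub>R f t) \<longlonglongrightarrow> (LINT t:{a<..<b}|lebesgue. f t)"
      unfolding set_lebesgue_integral_def
    proof (rule integral_dominated_convergence)
      show "integrable lebesgue (\<lambda>t. norm (indicator {a<..<b} t *\<^sub>R f t))"
        using int unfolding set_integrable_def by (rule integrable_norm)
      show "(\<lambda>t. indicator {a<..<b} t *\<^sub>R f t) \<in> borel_measurable lebesgue"
        using int unfolding set_integrable_def by (rule borel_measurable_integrable)
      show "(\<lambda>t. indicator {a<..<b} t *\<^sub>R \<eta> k t *\<^sub>R f t) \<in> borel_measurable lebesgue" for k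
        using borel_measurable_scaleR[OF borel_measurable_lebesgue_continuous[OF test_function_on_continuous(1)[OF T[of k]]]
          \<open>(\<lambda>t. indicator {a<..<b} t *\<^sub>R f t) \<in> borel_measurable lebesgue\<close>]
        by (simp add: mult.commute)
      show "AE t in lebesgue. (\<lambda>k. indicator {a<..<b} t *\<^sub>R \<eta> k t *\<^sub>R f t) \<longlonglongrightarrow> indicator {a<..<b} t *\<^sub>R f t"
      proof (rule AE_I2)
        fix t show "(\<lambda>k. indicator {a<..<b} t *\<^sub>R \<eta> k t *\<^sub>R f t) \<longlonglongrightarrow> indicator {a<..<b} t *\<^sub>R f t"
          using tendsto_scaleR[OF bspec[OF lim] tendsto_const[of "f t"], of t] by (cases "t \<in> {a<..<b}") auto
      qed
      show "AE t in lebesgue. norm (indicator {a<..<b} t *\<^sub>R \<eta> k t *\<^sub>R f t) \<le> norm (indicator {a<..<b} t *\<^sub>R f t)" for k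
        using le by (intro AE_I2) (auto simp: indicator_def intro: mult_left_le_one_le)
    qed
    moreover have "(LINT t:{a<..<b}|lebesgue. \<eta> k t *\<^sub>R f t) = 0" for k
    proof -
      have "(LINT t:{0<..}|lebesgue. \<eta> k t *\<^sub>R f t) = (LINT t:{a<..<b}|lebesgue. \<eta> k t *\<^sub>R f t)"
        using z that by (intro set_integrable_restrict_support(2)) auto
      with 0[OF T[of k]] show ?thesis by simp
    qed
    ultimately have "(LINT t:{a<..<b}|lebesgue. f t) = 0" by (simp add: LIMSEQ_const_iff)
    moreover have "(LINT t:{a..b}|lebesgue. f t) = (LINT t:{a<..<b}|lebesgue. f t)"
    proof (rule set_integral_cong_set)
      have "AE t in lebesgue. t \<noteq> a" "AE t in lebesgue. t \<noteq> b"
        using AE_lborel_singleton by (auto intro: AE_completion)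
      then show "AE t in lebesgue. t \<in> {a<..<b} \<longleftrightarrow> t \<in> {a..b}"
        by eventually_elim auto
    qed (use int locally_integrableD[OF f that, of b] in
        \<open>auto simp: set_borel_measurable_def set_integrable_def\<close>)
    ultimately show ?thesis by simp
  next
    case False
    then have "{a..b} = {} \<or> {a..b} = {a}" by auto
    then show ?thesis
    proof
      assume eq: "{a..b} = {a}"
      have "(LINT t:{a..b}|lebesgue. f t) = (LINT t:{}|lebesgue. f t)"
      proof (rule set_integral_cong_set)
        show "AE t in lebesgue. t \<in> {} \<longleftrightarrow> t \<in> {a..b}"
          using AE_completion[OF AE_lborel_singleton[of a]] unfolding eq by eventually_elim simp
      qed (use locally_integrableD[OF f that, of b] in
          \<open>auto simp: set_borel_measurable_def set_integrable_def\<close>)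
      then show ?thesis by (simp add: set_lebesgue_integral_def)
    qed (simp add: set_lebesgue_integral_def)
  qed
  \<comment> \<open>\<open>Suc n\<close> keeps the left endpoint positive; with \<open>n\<close> the
    case 0 would divide by zero and give the endpoint 0.\<close>
  have "AE t in lebesgue. t \<in> {1 / real (Suc n)..real n} \<longrightarrow> f t = 0" for n
  proof -
    let ?c = "1 / real (Suc n)"
    have "AE t in lebesgue. indicator {?c..real n} t *\<^sub>R f t = 0"
    proof (rule AE_zero_if_interval_integrals_zero)
      show "integrable lebesgue (\<lambda>t. indicator {?c..real n} t *\<^sub>R f t)"
        using locally_integrableD[OF f, of ?c "real n"] by (simp add: set_integrable_def)
      show "(LINT t|lebesgue. indicator {?c..real n} t *\<^sub>R f t) = 0"
        using ab[of ?c "real n"] by (simp add: set_lebesgue_integral_def)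
      fix a b :: real
      have "(LINT t:{a..b}|lebesgue. indicator {?c..real n} t *\<^sub>R f t) = (LINT t:{max a ?c..min b (real n)}|lebesgue. f t)"
        unfolding set_lebesgue_integral_def
        by (rule Bochner_Integration.integral_cong) (auto simp: indicator_def)
      also have "\<dots> = 0" by (rule ab) (simp add: less_max_iff_disj)
      finally show "(LINT t:{a..b}|lebesgue. indicator {?c..real n} t *\<^sub>R f t) = 0" .
    qed
    then show ?thesis by eventually_elim (auto simp: indicator_def)
  qed
  then have "AE t in lebesgue. \<forall>n. t \<in> {1 / real (Suc n)..real n} \<longrightarrow> f t = 0"
    unfolding AE_all_countable by blast
  then show ?thesis
  proof eventually_elim
    case (elim t)
    show ?case
    proof
      assume "0 < t"
      obtain m where m: "t \<le> real m" using real_arch_simple by blast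
      obtain k where k: "1 / real (Suc k) < t" using nat_approx_posE[OF \<open>0 < t\<close>] by (auto simp: inverse_eq_divide)
      have "1 / real (Suc (max m k)) \<le> 1 / real (Suc k)" by (intro divide_left_mono) auto
      then have "t \<in> {1 / real (Suc (max m k))..real (max m k)}" using m k by auto
      with elim show "f t = 0" by blast
    qed
  qed
qed

section \<open>From weak to classical derivatives\<close>

lemma continuous_antiderivative:
  fixes g :: "real \<Rightarrow> 'b::euclidean_space"
  assumes "continuous_on UNIV g"
  shows "\<exists>F. \<forall>t. (F has_vector_derivative g t) (at t)"
proof -
  have "\<And>x. isCont g x" using assms by (simp add: continuous_on_eq_continuous_at)
  then have "\<exists>F. \<forall>x::real. -\<infinity> < ereal x \<longrightarrow> ereal x < \<infinity> \<longrightarrow> (F has_vector_derivative g x) (at x)"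
    by (intro einterval_antiderivative) auto
  then show ?thesis by auto
qed

text \<open>The constant is the integral of \<open>f\<close> against a test function
  \<open>\<eta>0\<close> of integral 1. Removing \<open>I \<psi>\<close> times
  \<open>\<eta>0\<close> from a test function \<psi> leaves integral zero, hence the derivative of a
  test function, and \<open>f\<close> integrates to 0 against it. This says that
  \<open>f - c\<close> is orthogonal to every \<psi>.\<close>

lemma du_Bois_Reymond:
  fixes f :: "real \<Rightarrow> 'b::euclidean_space"
  assumes f: "locally_integrable f"
    and 0: "\<And>\<eta>. test_function_on {0<..} \<eta> \<Longrightarrow> (LINT t:{0<..}|lebesgue. deriv \<eta> t *\<^sub>R f t) = 0"
  obtains c where "AE t in lebesgue. 0 < t \<longrightarrow> f t = c"
proof -
  define I where "I \<eta> = (LINT t:{0<..}|lebesgue. \<eta> t)" for \<eta> :: "real \<Rightarrow> real"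
  have li1: "locally_integrable (\<lambda>_. 1 :: real)"
    by (intro locally_integrable_continuous continuous_intros)
  have Iint: "set_integrable lebesgue {0<..} \<eta>" if "test_function_on {0<..} \<eta>" for \<eta>
    using test_function_integrable(1)[OF li1 that] by simp
  obtain \<eta>0 where \<eta>0: "test_function_on {0<..} \<eta>0" and I0: "I \<eta>0 = 1"
  proof -
    obtain \<beta> :: "nat \<Rightarrow> real \<Rightarrow> real" where
      T: "\<forall>S k. {1..2} \<subseteq> S \<longrightarrow> test_function_on S (\<beta> k)"
      and le: "\<forall>k t. 0 \<le> \<beta> k t \<and> \<beta> k t \<le> 1" and pos: "\<forall>k>0. \<forall>t\<in>{1<..<2}. 0 < \<beta> k t"
      using bump_functions[of 1 2] by (metis one_less_numeral_iff semiring_norm(76))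
    define \<theta> where "\<theta> = \<beta> 1"
    have \<theta>: "test_function_on {0<..} \<theta>" unfolding \<theta>_def by (rule T[rule_format]) auto
    have "I \<theta> \<noteq> 0"
    proof
      assume "I \<theta> = 0"
      then have "AE t in lebesgue. indicator {0<..} t *\<^sub>R \<theta> t = 0"
        unfolding I_def set_lebesgue_integral_def
        by (subst (asm) integral_nonneg_eq_0_iff_AE)
          (use Iint[OF \<theta>] le in \<open>auto simp: set_integrable_def \<theta>_def\<close>)
      \<comment> \<open>Positivity of \<theta> on (1, 2) makes almost every point of this interval a
        member of the empty set. That set is closed, and a closed set containing almost every point
        of an open set contains all of it, here 3/2.\<close>
      then have "AE t in lebesgue. t \<in> {1<..<2} \<longrightarrow> t \<in> ({} :: real set)"
      proof eventually_elim
        case (elim t)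
        then show ?case using pos[rule_format, of 1 t] by (auto simp: \<theta>_def indicator_def split: if_splits)
      qed
      then have "(3 / 2 :: real) \<in> {}"
        using mem_closed_if_AE_lebesgue_open[of "{1<..<2}" "{}" "3 / 2 :: real"] by simp
      then show False by simp
    qed
    define \<eta>0 where "\<eta>0 t = \<theta> t / I \<theta>" for t
    obtain a b where ab: "0 < a" "\<forall>t. t \<notin> {a<..<b} \<longrightarrow> \<theta> t = 0 \<and> deriv \<theta> t = 0"
      using test_function_on_support[OF \<theta>] by metis
    have "test_function_on {0<..} \<eta>0"
    proof (rule test_function_onI(1)[where \<eta>' = "\<lambda>t. deriv \<theta> t / I \<theta>" and a = a and b = b])
      show "(\<eta>0 has_real_derivative deriv \<theta> t / I \<theta>) (at t)" for t
        unfolding \<eta>0_def[abs_def] by (intro DERIV_cdivide test_function_on_DERIV[OF \<theta>])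
      show "continuous_on UNIV (\<lambda>t. deriv \<theta> t / I \<theta>)"
        using \<open>I \<theta> \<noteq> 0\<close> by (intro continuous_intros test_function_on_continuous[OF \<theta>]) auto
    qed (use ab in \<open>auto simp: \<eta>0_def\<close>)
    moreover have "I \<eta>0 = 1" using \<open>I \<theta> \<noteq> 0\<close> unfolding I_def \<eta>0_def by simp
    ultimately show thesis by (rule that)
  qed
  define c where "c = (LINT t:{0<..}|lebesgue. \<eta>0 t *\<^sub>R f t)"
  have lic: "locally_integrable (\<lambda>_. c)" by (intro locally_integrable_continuous continuous_intros)
  have "AE t in lebesgue. 0 < t \<longrightarrow> f t - c = 0"
  proof (rule fundamental_lemma_calculus_of_variations)
    show "locally_integrable (\<lambda>t. f t - c)"
      using f lic unfolding locally_integrable_def by (intro allI impI set_integral_diff) auto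
    fix \<psi> assume \<psi>: "test_function_on {0<..} \<psi>"
    \<comment> \<open>\<open>\<zeta>\<close> has integral zero, so its antiderivative is a test function.\<close>
    define \<zeta> where "\<zeta> t = \<psi> t - I \<psi> * \<eta>0 t" for t
    have c\<zeta>: "continuous_on UNIV \<zeta>" unfolding \<zeta>_def[abs_def]
      by (intro continuous_intros test_function_on_continuous[OF \<psi>] test_function_on_continuous[OF \<eta>0])
    obtain a b where ab: "0 < a" "a < b" "\<forall>t. t \<notin> {a<..<b} \<longrightarrow> \<psi> t = 0 \<and> deriv \<psi> t = 0"
      using test_function_on_support[OF \<psi>] by metis
    obtain a0 b0 where ab0: "0 < a0" "a0 < b0" "\<forall>t. t \<notin> {a0<..<b0} \<longrightarrow> \<eta>0 t = 0 \<and> deriv \<eta>0 t = 0"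
      using test_function_on_support[OF \<eta>0] by metis
    define A B where "A = min a a0" "B = max b b0"
    have AB: "0 < A" "A < B" using ab ab0 by (auto simp: A_B_def)
    have \<zeta>z: "\<zeta> t = 0" if "t \<notin> {A<..<B}" for t
    proof -
      have "\<psi> t = 0" "\<eta>0 t = 0" using ab(3) ab0(3) that by (auto simp: A_B_def min_less_iff_disj less_max_iff_disj)
      then show ?thesis by (simp add: \<zeta>_def)
    qed
    obtain F where F: "\<And>t. (F has_vector_derivative \<zeta> t) (at t)"
      using continuous_antiderivative[OF c\<zeta>] by blast
    have FD: "(F has_real_derivative \<zeta> t) (at t within S)" for t S
      using F[of t] by (auto simp: has_real_derivative_iff_has_vector_derivative intro: has_vector_derivative_at_within)
    have \<zeta>int: "set_integrable lebesgue {A..B} \<zeta>"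
      by (intro absolutely_integrable_continuous_real continuous_on_subset[OF c\<zeta>]) auto
    have "I \<zeta> = I \<psi> - I \<psi> * I \<eta>0"
      unfolding I_def \<zeta>_def[abs_def] using Iint[OF \<psi>] Iint[OF \<eta>0] by (simp add: set_integrable_mult_right)
    then have "I \<zeta> = 0" by (simp add: I0)
    moreover have "I \<zeta> = (LINT t:{A..B}|lebesgue. \<zeta> t)"
      unfolding I_def using AB \<zeta>z by (intro set_integrable_restrict_support(2)) auto
    ultimately have "integral {A..B} \<zeta> = 0"
      using set_lebesgue_integral_eq_integral(2)[OF \<zeta>int] by simp
    moreover have "(\<zeta> has_integral F B - F A) {A..B}"
      using AB F by (intro fundamental_theorem_of_calculus) (auto intro: has_vector_derivative_at_within)
    ultimately have FAB: "F B = F A" by (simp add: integral_unique)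
    \<comment> \<open>Left of \<open>A\<close> and right of \<open>B\<close> the antiderivative is
      constant since \<zeta> vanishes there; both constants agree because \<zeta> has integral zero
      (\<open>FAB\<close>).\<close>
    define \<eta> where "\<eta> t = F t - F A" for t
    have z: "\<eta> t = 0" if "t \<notin> {A..B}" for t
    proof (cases "t < A")
      case True
      have "\<exists>k. \<forall>s\<in>{..A}. F s = k"
        using FD by (intro has_field_derivative_zero_constant) (metis \<zeta>z atMost_iff convex_real_interval(2) greaterThanLessThan_iff leD)+
      then show ?thesis using True by (auto simp: \<eta>_def)
    next
      case False
      have "\<exists>k. \<forall>s\<in>{B..}. F s = k"
        using FD by (intro has_field_derivative_zero_constant) (metis \<zeta>z atLeast_iff convex_real_interval(1) greaterThanLessThan_iff leD)+
      then show ?thesis using False that FAB by (auto simp: \<eta>_def)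
    qed
    have d: "(\<eta> has_real_derivative \<zeta> t) (at t)" for t
      using DERIV_diff[OF FD[of t UNIV] DERIV_const[of "F A"]] by (simp add: \<eta>_def[abs_def])
    have AB0: "{A..B} \<subseteq> {0<..}" using AB by auto
    have \<eta>: "test_function_on {0<..} \<eta>" "deriv \<eta> = \<zeta>"
      using test_function_onI[OF d c\<zeta> AB0 z] by auto
    have "0 = (LINT t:{0<..}|lebesgue. \<zeta> t *\<^sub>R f t)" using 0[OF \<eta>(1)] by (simp add: \<eta>(2))
    also have "\<dots> = (LINT t:{0<..}|lebesgue. \<psi> t *\<^sub>R f t - I \<psi> *\<^sub>R (\<eta>0 t *\<^sub>R f t))"
      by (simp add: \<zeta>_def scaleR_diff_left)
    also have "\<dots> = (LINT t:{0<..}|lebesgue. \<psi> t *\<^sub>R f t) - I \<psi> *\<^sub>R c"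
      unfolding c_def using test_function_integrable(1)[OF f \<psi>] test_function_integrable(1)[OF f \<eta>0]
      by (subst set_integral_diff(2)) (auto intro!: set_integrable_scaleR_right simp del: scaleR_scaleR)
    also have "I \<psi> *\<^sub>R c = (LINT t:{0<..}|lebesgue. \<psi> t *\<^sub>R c)"
      using Iint[OF \<psi>] unfolding I_def by (simp add: set_lebesgue_integral_def set_integrable_def)
    also have "(LINT t:{0<..}|lebesgue. \<psi> t *\<^sub>R f t) - \<dots> = (LINT t:{0<..}|lebesgue. \<psi> t *\<^sub>R (f t - c))"
      using test_function_integrable(1)[OF f \<psi>] test_function_integrable(1)[OF lic \<psi>]
      by (simp add: scaleR_diff_right)
    finally show "(LINT t:{0<..}|lebesgue. \<psi> t *\<^sub>R (f t - c)) = 0" by simp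
  qed
  then show thesis by (intro that[of c]) simp
qed

text \<open>Subtracting a classical antiderivative of \<open>G\<close> leaves a function with weak
  derivative zero, which is constant. It is applied twice: to the weak velocity with forcing
  \<open>grad q (\<phi> t)\<close>, then to \<phi> itself with the continuous velocity so
  obtained.\<close>

lemma weak_derivative_antiderivative:
  fixes f G :: "real \<Rightarrow> 'b::euclidean_space"
  assumes f: "locally_integrable f" and G: "continuous_on {0..} G"
    and weak: "\<And>\<eta>. test_function_on {0<..} \<eta> \<Longrightarrow>
      (LINT t:{0<..}|lebesgue. deriv \<eta> t *\<^sub>R f t) = - (LINT t:{0<..}|lebesgue. \<eta> t *\<^sub>R G t)"
  obtains F where "\<forall>t\<ge>0. (F has_vector_derivative G t) (at t within {0..})"
    "AE t in lebesgue. 0 < t \<longrightarrow> f t = F t"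
proof -
  \<comment> \<open>Freezing \<open>G\<close> at its value at 0 for negative times gives a
    continuous function on the line, so the antiderivative is differentiable at 0 as well.\<close>
  have "continuous_on UNIV (\<lambda>t. G (max 0 t))"
    by (intro continuous_on_compose2[OF G] continuous_intros) auto
  then obtain P where P: "\<And>t. (P has_vector_derivative G (max 0 t)) (at t)"
    using continuous_antiderivative by blast
  have cP: "continuous_on {0..} P"
  proof (rule continuous_on_vector_derivative)
    show "(P has_vector_derivative G (max 0 t)) (at t within {0..})" for t
      using P by (rule has_vector_derivative_at_within)
  qed
  note liP = locally_integrable_continuous[OF cP]
  have "locally_integrable (\<lambda>t. f t - P t)"
    using f liP unfolding locally_integrable_def by (intro allI impI set_integral_diff) auto
  then obtain c where c: "AE t in lebesgue. 0 < t \<longrightarrow> f t - P t = c"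
  proof (rule du_Bois_Reymond)
    fix \<eta> assume \<eta>: "test_function_on {0<..} \<eta>"
    have "(LINT t:{0<..}|lebesgue. deriv \<eta> t *\<^sub>R (f t - P t)) =
      (LINT t:{0<..}|lebesgue. deriv \<eta> t *\<^sub>R f t) - (LINT t:{0<..}|lebesgue. deriv \<eta> t *\<^sub>R P t)"
      using test_function_integrable(2)[OF f \<eta>] test_function_integrable(2)[OF liP \<eta>]
      by (simp add: scaleR_diff_right)
    also have "(LINT t:{0<..}|lebesgue. deriv \<eta> t *\<^sub>R P t) = - (LINT t:{0<..}|lebesgue. \<eta> t *\<^sub>R G t)"
    proof (rule integral_deriv_scaleR[OF \<eta>])
      show "(P has_vector_derivative G t) (at t)" if "0 < t" for t using P[of t] that by simp
    qed (use G in \<open>auto intro: continuous_on_subset\<close>)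
    finally show "(LINT t:{0<..}|lebesgue. deriv \<eta> t *\<^sub>R (f t - P t)) = 0"
      using weak[OF \<eta>] by simp
  qed
  show thesis
  proof (rule that[of "\<lambda>t. P t + c"]; (intro allI impI)?)
    fix t :: real assume "0 \<le> t"
    then show "((\<lambda>t. P t + c) has_vector_derivative G t) (at t within {0..})"
      using has_vector_derivative_add[OF has_vector_derivative_at_within[OF P[of t]] has_vector_derivative_const[of c]]
      by simp
  next
    show "AE t in lebesgue. 0 < t \<longrightarrow> f t = P t + c"
      using c by eventually_elim (auto simp: algebra_simps)
  qed
qed

text \<open>A set of full measure meets every open interval, so the closed coincidence set contains
  the open half line, and closure adds the endpoint 0.\<close>

lemma continuous_on_AE_eq:
  fixes f g :: "real \<Rightarrow> 'b::euclidean_space"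
  assumes "continuous_on {0..} f" "continuous_on {0..} g" "AE t in lebesgue. 0 < t \<longrightarrow> f t = g t" "0 \<le> t"
  shows "f t = g t"
proof -
  let ?C = "{t \<in> {0..}. f t - g t = 0}"
  have C: "closed ?C"
    using assms by (intro continuous_closed_preimage_constant continuous_intros) auto
  have "{0<..} \<subseteq> ?C"
  proof
    fix s :: real assume "s \<in> {0<..}"
    then show "s \<in> ?C"
      by (rule mem_closed_if_AE_lebesgue_open[OF open_greaterThan C, rotated]) (use assms(3) in auto)
  qed
  from closure_minimal[OF this C] assms(4) show ?thesis by auto
qed


section \<open>Weak velocities of curves in the torus\<close>

lemma abs_torus_eqD:
  assumes "abs_torus x = abs_torus y"
  obtains k :: int where "x $ i - y $ i = 2 * pi * of_int k"
  using assms unfolding abs_torus_eq_iff torus_rel_def by blast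

text \<open>The coordinates of the difference are continuous on a connected set and take values in
  the discrete set 2 pi Z.\<close>

lemma torus_lift_unique:
  fixes \<phi> \<psi> :: "real \<Rightarrow> real ^ 'n"
  assumes "continuous_on {0..} \<phi>" "continuous_on {0..} \<psi>"
    and eq: "\<forall>t\<ge>0. abs_torus (\<phi> t) = abs_torus (\<psi> t)"
  obtains c where "\<forall>t\<ge>0. \<psi> t = \<phi> t + c"
proof -
  have "(\<lambda>t. (\<psi> t - \<phi> t) $ i) constant_on {0..}" for i
  proof (rule continuous_discrete_range_constant)
    show "connected {0::real..}" by (simp add: convex_connected)
    show "continuous_on {0..} (\<lambda>t. (\<psi> t - \<phi> t) $ i)"
      using assms by (intro continuous_intros)
    fix x :: real assume x: "x \<in> {0..}"
    show "\<exists>e>0. \<forall>y. y \<in> {0..} \<and> (\<psi> y - \<phi> y) $ i \<noteq> (\<psi> x - \<phi> x) $ i \<longrightarrow>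
        e \<le> norm ((\<psi> y - \<phi> y) $ i - (\<psi> x - \<phi> x) $ i)"
    proof (intro exI[of _ "2 * pi"] conjI allI impI)
      fix y assume y: "y \<in> {0..} \<and> (\<psi> y - \<phi> y) $ i \<noteq> (\<psi> x - \<phi> x) $ i"
      obtain k l where kl: "\<phi> x $ i - \<psi> x $ i = 2 * pi * of_int k" "\<phi> y $ i - \<psi> y $ i = 2 * pi * of_int l"
        using abs_torus_eqD eq x y by (metis atLeast_iff)
      then have *: "(\<psi> y - \<phi> y) $ i - (\<psi> x - \<phi> x) $ i = 2 * pi * of_int (k - l)"
        by (simp add: algebra_simps)
      with y have "k - l \<noteq> 0" by auto
      then have "1 \<le> \<bar>real_of_int (k - l)\<bar>" by linarith
      then show "2 * pi \<le> norm ((\<psi> y - \<phi> y) $ i - (\<psi> x - \<phi> x) $ i)"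
        unfolding * real_norm_def abs_mult by simp
    qed simp
  qed
  then obtain c where "\<And>i t. t \<ge> 0 \<Longrightarrow> (\<psi> t - \<phi> t) $ i = c i"
    unfolding constant_on_def by (metis atLeast_iff)
  then have "\<forall>t\<ge>0. \<psi> t = \<phi> t + (\<chi> i. c i)"
    by (auto simp: vec_eq_iff algebra_simps)
  then show thesis by (rule that)
qed

section \<open>Square integrability and weak velocities on the half line\<close>

lemma L2_on_continuous:
  fixes f :: "real \<Rightarrow> 'b::euclidean_space"
  assumes "continuous_on {0..} f"
  shows "L2_on {0<..<T} f"
proof (cases "T > 0")
  case True
  have "continuous_on {0..} (\<lambda>t. (norm (f t))\<^sup>2)" using assms by (intro continuous_intros)
  from locally_integrable_continuous[OF this] locally_integrable_continuous[OF assms] True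
  show ?thesis
    unfolding L2_on_def locally_integrable_def set_integrable_def set_borel_measurable_def
    by auto
qed (simp add: L2_on_def set_integrable_def set_borel_measurable_def)

lemma L2_on_add:
  fixes f g :: "real \<Rightarrow> 'b::euclidean_space"
  assumes "L2_on S f" "L2_on S g" and S: "S \<in> sets lebesgue"
  shows "L2_on S (\<lambda>t. f t + g t)"
proof -
  have [measurable]: "(\<lambda>t. indicator S t *\<^sub>R f t) \<in> borel_measurable lebesgue"
    "(\<lambda>t. indicator S t *\<^sub>R g t) \<in> borel_measurable lebesgue"
    using assms by (auto simp: L2_on_def set_borel_measurable_def)
  have m: "(\<lambda>t. indicator S t *\<^sub>R (f t + g t)) \<in> borel_measurable lebesgue"
    unfolding scaleR_add_right by measurable
  have "(\<lambda>t. indicator S t *\<^sub>R (norm (f t + g t))\<^sup>2) = (\<lambda>t. (norm (indicator S t *\<^sub>R (f t + g t)))\<^sup>2)"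
    by (auto simp: indicator_def)
  then have m2: "(\<lambda>t. indicator S t *\<^sub>R (norm (f t + g t))\<^sup>2) \<in> borel_measurable lebesgue"
    using borel_measurable_power[OF measurable_compose[OF m borel_measurable_norm], of 2] by (simp only:)
  have "set_integrable lebesgue S (\<lambda>t. 2 * (norm (f t))\<^sup>2 + 2 * (norm (g t))\<^sup>2)"
    using assms by (auto simp: L2_on_def intro!: set_integral_add)
  then have "set_integrable lebesgue S (\<lambda>t. (norm (f t + g t))\<^sup>2)"
    unfolding set_integrable_def
  proof (rule Bochner_Integration.integrable_bound[OF _ m2], intro AE_I2)
    fix t
    have "norm (f t + g t) \<le> norm (f t) + norm (g t)" by (rule norm_triangle_ineq)
    then have "(norm (f t + g t))\<^sup>2 \<le> (norm (f t) + norm (g t))\<^sup>2" by (intro power_mono) auto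
    also have "\<dots> \<le> 2 * (norm (f t))\<^sup>2 + 2 * (norm (g t))\<^sup>2"
      using sum_squares_bound[of "norm (f t)" "norm (g t)"] by (simp add: power2_sum)
    finally show "norm (indicator S t *\<^sub>R (norm (f t + g t))\<^sup>2)
        \<le> norm (indicator S t *\<^sub>R (2 * (norm (f t))\<^sup>2 + 2 * (norm (g t))\<^sup>2))"
      by (auto simp: indicator_def)
  qed
  with m show ?thesis by (auto simp: L2_on_def set_borel_measurable_def)
qed

text \<open>On a bounded interval constants are integrable, and
  \<open>1 + (norm (u t))\<^sup>2\<close> dominates \<open>norm (u t)\<close>.\<close>

lemma L2_on_locally_integrable:
  fixes u :: "real \<Rightarrow> 'b::euclidean_space"
  assumes "\<And>T. T > 0 \<Longrightarrow> L2_on {0<..<T} u"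
  shows "locally_integrable u"
  unfolding locally_integrable_def
proof (intro allI impI)
  fix T :: real assume "0 < T"
  with assms have u: "set_borel_measurable lebesgue {0<..<T} u" "set_integrable lebesgue {0<..<T} (\<lambda>t. (norm (u t))\<^sup>2)"
    by (auto simp: L2_on_def)
  have "locally_integrable (\<lambda>_. 1 :: real)" by (intro locally_integrable_continuous continuous_intros)
  with \<open>0 < T\<close> have "set_integrable lebesgue {0<..<T} (\<lambda>_. 1 :: real)" by (simp add: locally_integrable_def)
  with u(2) have "set_integrable lebesgue {0<..<T} (\<lambda>t. 1 + (norm (u t))\<^sup>2)" by (rule set_integral_add[rotated])
  then show "set_integrable lebesgue {0<..<T} u"
    unfolding set_integrable_def
  proof (rule Bochner_Integration.integrable_bound)
    show "(\<lambda>t. indicator {0<..<T} t *\<^sub>R u t) \<in> borel_measurable lebesgue"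
      using u(1) by (simp add: set_borel_measurable_def)
    have "r \<le> 1 + r\<^sup>2" for r :: real
    proof -
      have "2 * r \<le> r\<^sup>2 + 1" "0 \<le> r\<^sup>2" using sum_squares_bound[of r 1] by auto
      then show ?thesis by linarith
    qed
    then show "AE t in lebesgue. norm (indicator {0<..<T} t *\<^sub>R u t) \<le> norm (indicator {0<..<T} t *\<^sub>R (1 + (norm (u t))\<^sup>2))"
      by (intro AE_I2) (auto simp: indicator_def)
  qed
qed

lemma test_function_on_mono:
  assumes "test_function_on S \<eta>" "S \<subseteq> S'"
  shows "test_function_on S' \<eta>"
proof -
  obtain K where "compact K" "K \<subseteq> S" "\<forall>t. t \<notin> K \<longrightarrow> \<eta> t = 0"
    using assms(1) unfolding test_function_on_def by blast
  with assms(2) have "\<exists>K. compact K \<and> K \<subseteq> S' \<and> (\<forall>t. t \<notin> K \<longrightarrow> \<eta> t = 0)"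
    by (intro exI[of _ K]) auto
  with assms(1) show ?thesis unfolding test_function_on_def by simp
qed

text \<open>A test function on the half line has compact support, so it is one on some bounded
  interval, and conversely. This removes the parameter \<open>T\<close> from the integral
  identity.\<close>

lemma has_weak_derivative_on_half_line:
  fixes \<phi> u :: "real \<Rightarrow> 'b::euclidean_space"
  shows "(\<forall>T>0. has_weak_derivative_on \<phi> u {0<..<T}) \<longleftrightarrow> has_weak_derivative_on \<phi> u {0<..}"
proof -
  have eq: "(LINT t:{0<..}|lebesgue. \<eta> t *\<^sub>R f t) = (LINT t:{0<..<T}|lebesgue. \<eta> t *\<^sub>R f t)"
    if "\<forall>t. t \<notin> {0<..<T} \<longrightarrow> \<eta> t = 0" for \<eta> and f :: "real \<Rightarrow> 'b" and T
    using that by (intro set_integrable_restrict_support(2)) auto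
  show ?thesis
  proof
    assume *: "\<forall>T>0. has_weak_derivative_on \<phi> u {0<..<T}"
    show "has_weak_derivative_on \<phi> u {0<..}"
      unfolding has_weak_derivative_on_def
    proof (intro allI impI)
      fix \<eta> assume \<eta>: "test_function_on {0<..} \<eta>"
      obtain a b where ab: "0 < a" "a < b" "\<forall>t. t \<notin> {a<..<b} \<longrightarrow> \<eta> t = 0 \<and> deriv \<eta> t = 0"
        using test_function_on_support[OF \<eta>] by metis
      have "test_function_on {0<..<b + 1} \<eta>"
        using ab test_function_on_DERIV[OF \<eta>] test_function_on_continuous(2)[OF \<eta>]
        by (intro test_function_onI(1)[where a = a and b = b]) auto
      with * ab have "(LINT t:{0<..<b + 1}|lebesgue. deriv \<eta> t *\<^sub>R \<phi> t) = - (LINT t:{0<..<b + 1}|lebesgue. \<eta> t *\<^sub>R u t)"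
        unfolding has_weak_derivative_on_def by auto
      moreover have "\<forall>t. t \<notin> {0<..<b + 1} \<longrightarrow> \<eta> t = 0" "\<forall>t. t \<notin> {0<..<b + 1} \<longrightarrow> deriv \<eta> t = 0"
        using ab by auto
      ultimately show "(LINT t:{0<..}|lebesgue. deriv \<eta> t *\<^sub>R \<phi> t) = - (LINT t:{0<..}|lebesgue. \<eta> t *\<^sub>R u t)"
        using eq by simp
    qed
  next
    assume *: "has_weak_derivative_on \<phi> u {0<..}"
    show "\<forall>T>0. has_weak_derivative_on \<phi> u {0<..<T}"
      unfolding has_weak_derivative_on_def
    proof (intro allI impI)
      fix T :: real and \<eta> assume \<eta>: "test_function_on {0<..<T} \<eta>"
      then have "test_function_on {0<..} \<eta>" by (rule test_function_on_mono) auto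
      with * have "(LINT t:{0<..}|lebesgue. deriv \<eta> t *\<^sub>R \<phi> t) = - (LINT t:{0<..}|lebesgue. \<eta> t *\<^sub>R u t)"
        unfolding has_weak_derivative_on_def by auto
      moreover obtain K where "K \<subseteq> {0<..<T}" "\<forall>t. t \<notin> K \<longrightarrow> \<eta> t = 0 \<and> deriv \<eta> t = 0"
        using test_function_on_vanishes[OF \<eta>] by metis
      then have "\<forall>t. t \<notin> {0<..<T} \<longrightarrow> \<eta> t = 0" "\<forall>t. t \<notin> {0<..<T} \<longrightarrow> deriv \<eta> t = 0" by blast+
      ultimately show "(LINT t:{0<..<T}|lebesgue. deriv \<eta> t *\<^sub>R \<phi> t) = - (LINT t:{0<..<T}|lebesgue. \<eta> t *\<^sub>R u t)"
        using eq[of T \<eta>] eq[of T "deriv \<eta>"] by simp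
    qed
  qed
qed

lemma weak_velocity_of_iff:
  "weak_velocity_of \<Phi> u \<longleftrightarrow>
     (\<exists>\<phi>. continuous_on {0..} \<phi> \<and> (\<forall>t\<ge>0. abs_torus (\<phi> t) = \<Phi> t) \<and>
       (\<forall>T>0. L2_on {0<..<T} u) \<and> has_weak_derivative_on \<phi> u {0<..})"
  unfolding weak_velocity_of_def has_weak_derivative_on_half_line[symmetric]
  using L2_on_continuous by blast

text \<open>Two lifts differ by a constant, which has weak derivative zero, so the difference of the
  velocities is orthogonal to all test functions. This makes \<open>weak_velocity\<close>, a mere
  choice, well defined up to null sets.\<close>

lemma weak_velocity_unique:
  assumes "weak_velocity_of \<Phi> u" "weak_velocity_of \<Phi> v"
  shows "AE t in lebesgue. 0 < t \<longrightarrow> u t = v t"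
proof -
  obtain \<phi> where \<phi>: "continuous_on {0..} \<phi>" "\<forall>t\<ge>0. abs_torus (\<phi> t) = \<Phi> t"
    and u: "\<forall>T>0. L2_on {0<..<T} u" and wu: "has_weak_derivative_on \<phi> u {0<..}"
    using assms(1) unfolding weak_velocity_of_iff by blast
  obtain \<psi> where \<psi>: "continuous_on {0..} \<psi>" "\<forall>t\<ge>0. abs_torus (\<psi> t) = \<Phi> t"
    and v: "\<forall>T>0. L2_on {0<..<T} v" and wv: "has_weak_derivative_on \<psi> v {0<..}"
    using assms(2) unfolding weak_velocity_of_iff by blast
  obtain c where c: "\<forall>t\<ge>0. \<psi> t = \<phi> t + c"
    using torus_lift_unique[OF \<phi>(1) \<psi>(1)] \<phi>(2) \<psi>(2) by metis
  have lu: "locally_integrable u" and lv: "locally_integrable v"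
    using L2_on_locally_integrable u v by blast+
  have "AE t in lebesgue. 0 < t \<longrightarrow> u t - v t = 0"
  proof (rule fundamental_lemma_calculus_of_variations)
    show "locally_integrable (\<lambda>t. u t - v t)"
      using lu lv unfolding locally_integrable_def by (intro allI impI set_integral_diff) auto
    fix \<eta> assume \<eta>: "test_function_on {0<..} \<eta>"
    have 0: "(LINT t:{0<..}|lebesgue. deriv \<eta> t *\<^sub>R c) = 0"
      using integral_deriv_scaleR[OF \<eta>, of "\<lambda>_. c" "\<lambda>_. 0"] by simp
    have lc: "locally_integrable (\<lambda>_. c)" by (intro locally_integrable_continuous continuous_intros)
    have "(LINT t:{0<..}|lebesgue. \<eta> t *\<^sub>R (u t - v t)) =
      (LINT t:{0<..}|lebesgue. \<eta> t *\<^sub>R u t) - (LINT t:{0<..}|lebesgue. \<eta> t *\<^sub>R v t)"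
      using test_function_integrable(1)[OF lu \<eta>] test_function_integrable(1)[OF lv \<eta>]
      by (simp add: scaleR_diff_right)
    also have "\<dots> = (LINT t:{0<..}|lebesgue. deriv \<eta> t *\<^sub>R \<psi> t) - (LINT t:{0<..}|lebesgue. deriv \<eta> t *\<^sub>R \<phi> t)"
      using wu wv \<eta> unfolding has_weak_derivative_on_def by auto
    also have "(LINT t:{0<..}|lebesgue. deriv \<eta> t *\<^sub>R \<psi> t) = (LINT t:{0<..}|lebesgue. deriv \<eta> t *\<^sub>R \<phi> t + deriv \<eta> t *\<^sub>R c)"
      using c by (intro set_lebesgue_integral_cong) (auto simp: scaleR_add_right)
    also have "\<dots> = (LINT t:{0<..}|lebesgue. deriv \<eta> t *\<^sub>R \<phi> t)"
      using test_function_integrable(2)[OF locally_integrable_continuous[OF \<phi>(1)] \<eta>] test_function_integrable(2)[OF lc \<eta>] 0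
      by simp
    finally show "(LINT t:{0<..}|lebesgue. \<eta> t *\<^sub>R (u t - v t)) = 0" by simp
  qed
  then show ?thesis by simp
qed

text \<open>Competitors are built in Euclidean space and projected to the torus. The support of
  \<eta> avoids 0, so the starting point is kept.\<close>

lemma weak_velocity_of_perturbation:
  fixes \<phi> u :: "real \<Rightarrow> real ^ 'n"
  assumes \<phi>: "continuous_on {0..} \<phi>" and u: "\<forall>T>0. L2_on {0<..<T} u"
    and w: "has_weak_derivative_on \<phi> u {0<..}" and \<eta>: "test_function_on {0<..} \<eta>"
  shows "weak_velocity_of (\<lambda>t. abs_torus (\<phi> t + \<eta> t *\<^sub>R e)) (\<lambda>t. u t + deriv \<eta> t *\<^sub>R e)"
proof -
  have c1: "continuous_on {0..} (\<lambda>t. \<eta> t *\<^sub>R e)" and c2: "continuous_on {0..} (\<lambda>t. deriv \<eta> t *\<^sub>R e)"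
    by (intro continuous_intros test_function_on_continuous[OF \<eta>])+
  note l1 = locally_integrable_continuous[OF c1] and l2 = locally_integrable_continuous[OF c2]
  note lphi = locally_integrable_continuous[OF \<phi>]
  have lu: "locally_integrable u" using L2_on_locally_integrable u by blast
  have "continuous_on {0..} (\<lambda>t. \<phi> t + \<eta> t *\<^sub>R e)" using \<phi> c1 by (rule continuous_on_add)
  moreover have "\<forall>T>0. L2_on {0<..<T} (\<lambda>t. u t + deriv \<eta> t *\<^sub>R e)"
    using u L2_on_continuous[OF c2] by (auto intro: L2_on_add)
  moreover have "has_weak_derivative_on (\<lambda>t. \<phi> t + \<eta> t *\<^sub>R e) (\<lambda>t. u t + deriv \<eta> t *\<^sub>R e) {0<..}"
    unfolding has_weak_derivative_on_def
  proof (intro allI impI)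
    fix \<theta> assume \<theta>: "test_function_on {0<..} \<theta>"
    have "(LINT t:{0<..}|lebesgue. deriv \<theta> t *\<^sub>R (\<eta> t *\<^sub>R e)) = - (LINT t:{0<..}|lebesgue. \<theta> t *\<^sub>R (deriv \<eta> t *\<^sub>R e))"
    proof (rule integral_deriv_scaleR[OF \<theta>])
      show "((\<lambda>t. \<eta> t *\<^sub>R e) has_vector_derivative deriv \<eta> t *\<^sub>R e) (at t)" for t
        using has_vector_derivative_scaleR[OF test_function_on_DERIV[OF \<eta>, of t] has_vector_derivative_const[of e]]
        by simp
    qed (use c2 in \<open>auto intro: continuous_on_subset\<close>)
    then show "(LINT t:{0<..}|lebesgue. deriv \<theta> t *\<^sub>R (\<phi> t + \<eta> t *\<^sub>R e)) =
        - (LINT t:{0<..}|lebesgue. \<theta> t *\<^sub>R (u t + deriv \<eta> t *\<^sub>R e))"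
      using w \<theta> test_function_integrable(2)[OF lphi \<theta>] test_function_integrable(2)[OF l1 \<theta>]
        test_function_integrable(1)[OF lu \<theta>] test_function_integrable(1)[OF l2 \<theta>]
      unfolding has_weak_derivative_on_def scaleR_add_right by simp
  qed
  ultimately show ?thesis unfolding weak_velocity_of_iff by blast
qed


section \<open>The first variation of the action\<close>

text \<open>Lebesgue measure is complete, so \<open>g\<close> inherits measurability from
  \<open>f\<close>. This transfers integrals between Lagrangians whose velocities agree only almost
  everywhere.\<close>

lemma set_integrable_AE_cong:
  fixes f g :: "real \<Rightarrow> 'b::euclidean_space"
  assumes f: "set_integrable lebesgue S f" and ae: "AE t in lebesgue. t \<in> S \<longrightarrow> f t = g t"
  shows "set_integrable lebesgue S g" "(LINT t:S|lebesgue. g t) = (LINT t:S|lebesgue. f t)"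
proof -
  have ae': "AE t in lebesgue. indicator S t *\<^sub>R f t = indicator S t *\<^sub>R g t"
    using ae by eventually_elim (auto simp: indicator_def)
  have mf: "(\<lambda>t. indicator S t *\<^sub>R f t) \<in> borel_measurable lebesgue"
    using f unfolding set_integrable_def by (rule borel_measurable_integrable)
  have mg: "(\<lambda>t. indicator S t *\<^sub>R g t) \<in> borel_measurable lebesgue"
    by (rule borel_measurable_AE[OF mf ae'])
  show "set_integrable lebesgue S g"
    using integrable_cong_AE_imp[OF f[unfolded set_integrable_def] mg ae'] by (simp add: set_integrable_def)
  show "(LINT t:S|lebesgue. g t) = (LINT t:S|lebesgue. f t)"
    unfolding set_lebesgue_integral_def by (rule integral_cong_AE[OF mf mg ae', symmetric])
qed

lemma compactly_supported_integrable:
  fixes D :: "real \<Rightarrow> 'b::euclidean_space"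
  assumes "continuous_on {0..} D" "0 < a" "\<And>t. 0 < t \<Longrightarrow> t \<notin> {a<..<b} \<Longrightarrow> D t = 0"
  shows "set_integrable lebesgue {0<..} D"
proof -
  have "continuous_on {a..b} D" using assms(1) by (rule continuous_on_subset) (use assms(2) in auto)
  then have "set_integrable lebesgue {a..b} D" by (rule absolutely_integrable_continuous_real)
  then show ?thesis
    by (subst set_integrable_restrict_support(1)[where A = "{a..b}"]) (use assms in auto)
qed

lemma first_order_condition:
  fixes A B :: real
  assumes "\<And>s. \<bar>s\<bar> \<le> 1 \<Longrightarrow> 0 \<le> s * A + s\<^sup>2 * B"
  shows "A = 0"
proof (rule ccontr)
  assume "A \<noteq> 0"
  \<comment> \<open>\<open>d\<close> is at least |A| and exceeds \<open>B\<close>, so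
    \<open>s = - A / d\<close> is admissible and gives the value A^2 / d * (B / d - 1), which is
    negative.\<close>
  define d where "d = 1 + \<bar>A\<bar> + \<bar>B\<bar>"
  have d: "d > 0" by (simp add: d_def)
  have "\<bar>- A / d\<bar> \<le> 1" using d by (simp add: d_def abs_div)
  from assms[OF this] have "0 \<le> A\<^sup>2 / d * (B / d - 1)"
    using d by (simp add: power2_eq_square field_simps)
  moreover have "A\<^sup>2 / d * (B / d - 1) < 0"
    by (rule mult_pos_neg) (use d \<open>A \<noteq> 0\<close> in \<open>auto simp: d_def field_simps\<close>)
  ultimately show False by simp
qed

lemma weak_velocity_AE:
  assumes "weak_velocity_of \<Phi> u"
  shows "weak_velocity_of \<Phi> (weak_velocity \<Phi>)" "AE t in lebesgue. 0 < t \<longrightarrow> weak_velocity \<Phi> t = u t"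
proof -
  show *: "weak_velocity_of \<Phi> (weak_velocity \<Phi>)"
    unfolding weak_velocity_def by (rule someI[where P = "weak_velocity_of \<Phi>", OF assms])
  show "AE t in lebesgue. 0 < t \<longrightarrow> weak_velocity \<Phi> t = u t"
    using weak_velocity_unique[OF * assms] .
qed

text \<open>The Lagrangian of the competitor is \<open>l + H + D\<close>, with \<open>H\<close> the
  exact change of the kinetic part, a polynomial in \<open>s\<close>, and \<open>D\<close> the
  change of the potential. The Taylor estimate bounds \<open>H + D\<close> by
  \<open>s * (W t \<bullet> e)\<close> plus s^2 times \<open>M t\<close>, with \<open>M\<close>
  independent of \<open>s\<close>; minimality then gives the hypothesis of
  \<open>first_order_condition\<close>.\<close>

lemma minimizer_first_variation:
  fixes Q :: "'n::finite torus \<Rightarrow> real" and \<phi> :: "real \<Rightarrow> real ^ 'n"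
  assumes q_def: "\<And>x. q x = Q (abs_torus x)" and q: "real_analytic q" and min: "global_minimizer Q \<Phi>0 \<Phi>"
    and \<phi>: "continuous_on {0..} \<phi>" "\<forall>t\<ge>0. abs_torus (\<phi> t) = \<Phi> t"
    and u: "\<forall>T>0. L2_on {0<..<T} u" "has_weak_derivative_on \<phi> u {0<..}" "u = weak_velocity \<Phi>"
    and \<eta>: "test_function_on {0<..} \<eta>"
  shows "(LINT t:{0<..}|lebesgue. deriv \<eta> t *\<^sub>R u t + \<eta> t *\<^sub>R grad q (\<phi> t)) \<bullet> e = 0"
proof -
  have lu: "locally_integrable u" using L2_on_locally_integrable u(1) by blast
  have cG: "continuous_on {0..} (\<lambda>t. grad q (\<phi> t))"
    using continuous_on_compose2[OF continuous_on_grad[OF q, of UNIV] \<phi>(1)] by auto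
  obtain a b where ab: "0 < a" "a < b" "\<forall>t. t \<notin> {a<..<b} \<longrightarrow> \<eta> t = 0 \<and> deriv \<eta> t = 0"
    using test_function_on_support[OF \<eta>] by metis
  have c\<eta>: "continuous_on S \<eta>" "continuous_on S (deriv \<eta>)" for S
    by (rule test_function_on_continuous[OF \<eta>])+
  define W where "W t = deriv \<eta> t *\<^sub>R u t + \<eta> t *\<^sub>R grad q (\<phi> t)" for t
  have Wint: "set_integrable lebesgue {0<..} W"
    unfolding W_def[abs_def]
    using test_function_integrable(2)[OF lu \<eta>] test_function_integrable(1)[OF locally_integrable_continuous[OF cG] \<eta>]
    by (rule set_integral_add)
  \<comment> \<open>\<open>R\<close> bounds \<phi> and all its perturbations with |s| \<le> 1 on the
    support of \<eta>, so one Taylor constant \<open>L\<close> covers all these times and all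
    \<open>s\<close>.\<close>
  obtain R where R: "\<forall>t\<in>{a..b}. norm (\<phi> t) + \<bar>\<eta> t\<bar> * norm e \<le> R"
  proof -
    have "continuous_on {a..b} (\<lambda>t. norm (\<phi> t) + \<bar>\<eta> t\<bar> * norm e)"
      using continuous_on_subset[OF \<phi>(1), of "{a..b}"] ab(1) by (intro continuous_intros c\<eta>) auto
    then have "bounded ((\<lambda>t. norm (\<phi> t) + \<bar>\<eta> t\<bar> * norm e) ` {a..b})"
      by (intro compact_imp_bounded compact_continuous_image) auto
    then obtain R where "\<forall>z\<in>(\<lambda>t. norm (\<phi> t) + \<bar>\<eta> t\<bar> * norm e) ` {a..b}. norm z \<le> R"
      by (auto simp: bounded_iff)
    then have "\<forall>t\<in>{a..b}. norm (\<phi> t) + \<bar>\<eta> t\<bar> * norm e \<le> R" by (auto simp: abs_le_iff)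
    then show thesis by (rule that)
  qed
  obtain L where L: "L \<ge> 0" "\<forall>x\<in>cball 0 R. \<forall>y\<in>cball 0 R. \<bar>q y - q x - (y - x) \<bullet> grad q x\<bar> \<le> L * (norm (y - x))\<^sup>2"
    using real_analytic_taylor_bound[OF q] by blast
  define M where "M t = (1 / 2 * (deriv \<eta> t)\<^sup>2 + L * (\<eta> t)\<^sup>2) * (norm e)\<^sup>2" for t
  have Mint: "set_integrable lebesgue {0<..} M"
    by (rule compactly_supported_integrable[OF _ ab(1), of _ b])
      (use ab(3) in \<open>auto simp: M_def intro!: continuous_intros c\<eta>\<close>)
  define l where "l t = 1 / 2 * (norm (u t))\<^sup>2 + q (\<phi> t)" for t
  have l_eq: "lagrangian Q \<Phi> t = l t" if "t \<in> {0<..}" for t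
    using that \<phi>(2) by (simp add: lagrangian_def l_def u(3) q_def)
  have adm: "\<Phi> \<in> admissible Q \<Phi>0" and le: "\<And>\<Psi>. \<Psi> \<in> admissible Q \<Phi>0 \<Longrightarrow> action Q \<Phi> \<le> action Q \<Psi>"
    using min by (auto simp: global_minimizer_def)
  have "set_integrable lebesgue {0<..} (lagrangian Q \<Phi>)" using adm by (simp add: admissible_def)
  then have lint: "set_integrable lebesgue {0<..} l"
    by (rule set_integrable_AE_cong(1)) (auto simp: l_eq)
  have act: "action Q \<Phi> = (LINT t:{0<..}|lebesgue. l t)"
    unfolding action_def by (intro set_lebesgue_integral_cong) (auto simp: l_eq)
  have "0 \<le> s * ((LINT t:{0<..}|lebesgue. W t) \<bullet> e) + s\<^sup>2 * (LINT t:{0<..}|lebesgue. M t)" if s: "\<bar>s\<bar> \<le> 1" for s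
  proof -
    define \<psi> where "\<psi> t = \<phi> t + \<eta> t *\<^sub>R s *\<^sub>R e" for t
    define w where "w t = u t + deriv \<eta> t *\<^sub>R s *\<^sub>R e" for t
    define \<Psi> where "\<Psi> t = abs_torus (\<psi> t)" for t
    define D where "D t = q (\<psi> t) - q (\<phi> t)" for t
    define H where "H t = s * (deriv \<eta> t * (u t \<bullet> e)) + s\<^sup>2 / 2 * (deriv \<eta> t)\<^sup>2 * (norm e)\<^sup>2" for t
    have wv: "weak_velocity_of \<Psi> w"
      using weak_velocity_of_perturbation[OF \<phi>(1) u(1,2) \<eta>, of "s *\<^sub>R e"]
      by (simp add: \<Psi>_def[abs_def] \<psi>_def w_def[abs_def])
    have "set_integrable lebesgue {0<..} (\<lambda>t. (deriv \<eta> t *\<^sub>R u t) \<bullet> e)"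
      using test_function_integrable(2)[OF lu \<eta>] unfolding set_integrable_def
      by (simp flip: inner_scaleR_left)
    then have i1: "set_integrable lebesgue {0<..} (\<lambda>t. s * (deriv \<eta> t * (u t \<bullet> e)))"
      by (auto intro!: set_integrable_mult_right)
    have i2: "set_integrable lebesgue {0<..} (\<lambda>t. s\<^sup>2 / 2 * (deriv \<eta> t)\<^sup>2 * (norm e)\<^sup>2)"
      by (rule compactly_supported_integrable[OF _ ab(1), of _ b])
        (use ab(3) in \<open>auto intro!: continuous_intros c\<eta>\<close>)
    have Hint: "set_integrable lebesgue {0<..} H"
      unfolding H_def[abs_def] using i1 i2 by (rule set_integral_add)
    have c\<psi>: "continuous_on {0..} \<psi>"
      unfolding \<psi>_def[abs_def] by (intro continuous_intros \<phi>(1) c\<eta>)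
    have qc: "continuous_on UNIV q" by (rule real_analytic_continuous_on[OF q])
    have cD: "continuous_on {0..} D"
      unfolding D_def[abs_def]
      by (intro continuous_on_diff continuous_on_compose2[OF qc c\<psi>] continuous_on_compose2[OF qc \<phi>(1)]) auto
    have Dint: "set_integrable lebesgue {0<..} D"
      by (rule compactly_supported_integrable[OF cD ab(1), of b]) (use ab(3) in \<open>auto simp: D_def \<psi>_def\<close>)
    \<comment> \<open>Only almost everywhere: the Lagrangian of \<open>\<Psi>\<close> uses the
      chosen weak velocity, which need not be \<open>w\<close>.\<close>
    have eq: "AE t in lebesgue. t \<in> {0<..} \<longrightarrow> l t + H t + D t = lagrangian Q \<Psi> t"
      using weak_velocity_AE(2)[OF wv]
    proof eventually_elim
      case (elim t)
      have "(norm (w t))\<^sup>2 = (norm (u t))\<^sup>2 + 2 * H t"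
        unfolding w_def H_def power2_norm_eq_inner
        by (simp add: inner_add_left inner_add_right inner_commute power2_eq_square algebra_simps)
      with elim show ?case by (simp add: lagrangian_def l_def D_def \<Psi>_def q_def)
    qed
    note sint = set_integral_add(1)[OF set_integral_add(1)[OF lint Hint] Dint]
    have "set_integrable lebesgue {0<..} (lagrangian Q \<Psi>)"
      by (rule set_integrable_AE_cong(1)[OF sint eq])
    moreover have "\<Psi> 0 = \<Phi>0"
      using ab \<phi>(2) adm by (auto simp: \<Psi>_def \<psi>_def admissible_def)
    moreover have "\<Psi> \<in> H1_loc" using wv by (auto simp: H1_loc_def)
    ultimately have "\<Psi> \<in> admissible Q \<Phi>0" by (simp add: admissible_def)
    then have "action Q \<Phi> \<le> action Q \<Psi>" by (rule le)
    also have "action Q \<Psi> = (LINT t:{0<..}|lebesgue. l t + H t + D t)"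
      unfolding action_def by (rule set_integrable_AE_cong(2)[OF sint eq])
    also have "\<dots> \<le> (LINT t:{0<..}|lebesgue. l t + s * (W t \<bullet> e) + s\<^sup>2 * M t)"
    proof (rule set_integral_mono[OF sint])
      have "set_integrable lebesgue {0<..} (\<lambda>t. W t \<bullet> e)"
        using Wint unfolding set_integrable_def by (simp flip: inner_scaleR_left)
      then show "set_integrable lebesgue {0<..} (\<lambda>t. l t + s * (W t \<bullet> e) + s\<^sup>2 * M t)"
        using lint Mint by (intro set_integral_add(1) set_integrable_mult_right) auto
      fix t :: real assume "t \<in> {0<..}"
      show "l t + H t + D t \<le> l t + s * (W t \<bullet> e) + s\<^sup>2 * M t"
      proof (cases "t \<in> {a<..<b}")
        case False
        then have "\<eta> t = 0" "deriv \<eta> t = 0" using ab(3) by auto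
        then show ?thesis by (simp add: H_def D_def W_def M_def \<psi>_def)
      next
        case True
        then have Rt: "norm (\<phi> t) + \<bar>\<eta> t\<bar> * norm e \<le> R" using R by auto
        have 1: "norm (\<eta> t *\<^sub>R s *\<^sub>R e) \<le> \<bar>\<eta> t\<bar> * norm e"
        proof -
          have "\<bar>\<eta> t\<bar> * (\<bar>s\<bar> * norm e) \<le> \<bar>\<eta> t\<bar> * norm e"
            using s by (intro mult_left_mono mult_left_le_one_le) auto
          then show ?thesis by (simp add: abs_mult mult.assoc)
        qed
        have "norm (\<psi> t) \<le> R" unfolding \<psi>_def using 1 Rt norm_triangle_ineq[of "\<phi> t" "\<eta> t *\<^sub>R s *\<^sub>R e"] by linarith
        moreover have "0 \<le> \<bar>\<eta> t\<bar> * norm e" by simp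
        then have "norm (\<phi> t) \<le> R" using Rt by linarith
        ultimately have "\<bar>D t - (\<psi> t - \<phi> t) \<bullet> grad q (\<phi> t)\<bar> \<le> L * (norm (\<psi> t - \<phi> t))\<^sup>2"
          unfolding D_def using L(2) by simp
        then have "D t \<le> (\<psi> t - \<phi> t) \<bullet> grad q (\<phi> t) + L * (norm (\<psi> t - \<phi> t))\<^sup>2" by (simp add: abs_le_iff)
        also have "(\<psi> t - \<phi> t) \<bullet> grad q (\<phi> t) = s * (\<eta> t * (grad q (\<phi> t) \<bullet> e))"
          by (simp add: \<psi>_def inner_commute mult_ac)
        also have "L * (norm (\<psi> t - \<phi> t))\<^sup>2 = s\<^sup>2 * (L * (\<eta> t)\<^sup>2 * (norm e)\<^sup>2)"
          by (simp add: \<psi>_def power_mult_distrib mult_ac)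
        finally show ?thesis by (simp add: H_def W_def M_def inner_add_left algebra_simps)
      qed
    qed
    also have "\<dots> = (LINT t:{0<..}|lebesgue. l t) + s * ((LINT t:{0<..}|lebesgue. W t) \<bullet> e) + s\<^sup>2 * (LINT t:{0<..}|lebesgue. M t)"
    proof -
      have We: "set_integrable lebesgue {0<..} (\<lambda>t. W t \<bullet> e)" "(LINT t:{0<..}|lebesgue. W t \<bullet> e) = (LINT t:{0<..}|lebesgue. W t) \<bullet> e"
        using Wint integral_inner_left[of e lebesgue "\<lambda>t. indicator {0<..} t *\<^sub>R W t"]
        unfolding set_integrable_def set_lebesgue_integral_def by (simp_all flip: inner_scaleR_left)
      have "(LINT t:{0<..}|lebesgue. l t + s * (W t \<bullet> e) + s\<^sup>2 * M t) =
        (LINT t:{0<..}|lebesgue. l t) + (LINT t:{0<..}|lebesgue. s * (W t \<bullet> e)) + (LINT t:{0<..}|lebesgue. s\<^sup>2 * M t)"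
        using lint We(1) Mint by (simp add: set_integral_add set_integrable_mult_right)
      then show ?thesis using We(2) by simp
    qed
    finally show ?thesis using act by simp
  qed
  then have "(LINT t:{0<..}|lebesgue. W t) \<bullet> e = 0" by (rule first_order_condition)
  then show ?thesis by (simp add: W_def[abs_def])
qed


section \<open>Decay of zero-energy solutions of Newton's equation\<close>

lemma has_real_derivative_inner:
  fixes a b :: "real \<Rightarrow> 'a::real_inner"
  assumes "(a has_vector_derivative a') (at t within S)" "(b has_vector_derivative b') (at t within S)"
  shows "((\<lambda>t. a t \<bullet> b t) has_real_derivative a t \<bullet> b' + a' \<bullet> b t) (at t within S)"
  using bounded_bilinear.has_vector_derivative[OF bounded_bilinear_inner assms]
  by (simp add: has_real_derivative_iff_has_vector_derivative)

lemma emeasure_lebesgue_half_line: "emeasure lebesgue {0::real<..} = \<infinity>"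
proof (rule ccontr)
  assume "emeasure lebesgue {0::real<..} \<noteq> \<infinity>"
  then obtain m where m: "m \<ge> 0" "emeasure lebesgue {0::real<..} = ennreal m"
    by (cases "emeasure lebesgue {0::real<..}") auto
  have "ennreal (m + 1) = emeasure lebesgue {0<..<m + 1}" using m(1) by simp
  also have "\<dots> \<le> emeasure lebesgue {0::real<..}" by (intro emeasure_mono) auto
  finally show False using m by (simp add: ennreal_le_iff2)
qed

text \<open>Kinetic and potential part both change at the rate
  \<open>V t \<bullet> g (\<phi> t)\<close>, which cancels. For nonnegative \<open>f\<close> their
  difference is bounded by their sum, so a nonzero energy would make a nonzero constant integrable
  on a half line of infinite measure.\<close>

lemma newton_energy_zero:
  fixes \<phi> V :: "real \<Rightarrow> 'a::euclidean_space"
  assumes \<phi>: "\<And>t. 0 \<le> t \<Longrightarrow> (\<phi> has_vector_derivative V t) (at t within {0..})"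
    and V: "\<And>t. 0 \<le> t \<Longrightarrow> (V has_vector_derivative g (\<phi> t)) (at t within {0..})"
    and f: "\<And>x. (f has_derivative (\<lambda>h. h \<bullet> g x)) (at x)" and nonneg: "\<And>x. 0 \<le> f x"
    and int: "set_integrable lebesgue {0<..} (\<lambda>t. 1 / 2 * (norm (V t))\<^sup>2 + f (\<phi> t))"
    and t: "0 \<le> t"
  shows "(norm (V t))\<^sup>2 = 2 * f (\<phi> t)"
proof -
  define E where "E t = 1 / 2 * (V t \<bullet> V t) - f (\<phi> t)" for t
  have dE: "(E has_derivative (\<lambda>h. 0)) (at t within {0..})" if "0 \<le> t" for t
  proof -
    have "((\<lambda>t. f (\<phi> t)) has_derivative (\<lambda>h. (h *\<^sub>R V t) \<bullet> g (\<phi> t))) (at t within {0..})"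
      using has_derivative_compose[OF \<phi>[OF that, unfolded has_vector_derivative_def] f] .
    then have "((\<lambda>t. f (\<phi> t)) has_real_derivative V t \<bullet> g (\<phi> t)) (at t within {0..})"
      by (simp add: has_field_derivative_def mult_commute_abs)
    from DERIV_diff[OF DERIV_cmult[OF has_real_derivative_inner[OF V[OF that] V[OF that]], of "1 / 2"] this]
    have "(E has_real_derivative 0) (at t within {0..})"
      by (simp add: E_def[abs_def] inner_commute)
    then show ?thesis by (simp add: has_field_derivative_def lambda_zero)
  qed
  have "\<exists>c. \<forall>x\<in>{0..}. E x = c"
    by (rule has_derivative_zero_constant) (use dE in auto)
  then obtain c where c: "\<And>t. 0 \<le> t \<Longrightarrow> E t = c" by auto
  have "c = 0"
  proof (rule ccontr)
    assume "c \<noteq> 0"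
    have "integrable lebesgue (\<lambda>t::real. indicator {0<..} t *\<^sub>R \<bar>c\<bar>)"
    proof (rule Bochner_Integration.integrable_bound[OF int[unfolded set_integrable_def]])
      show "AE t in lebesgue. norm (indicator {0<..} t *\<^sub>R \<bar>c\<bar>)
          \<le> norm (indicator {0<..} t *\<^sub>R (1 / 2 * (norm (V t))\<^sup>2 + f (\<phi> t)))"
      proof (intro AE_I2)
        fix t :: real
        show "norm (indicator {0<..} t *\<^sub>R \<bar>c\<bar>)
          \<le> norm (indicator {0<..} t *\<^sub>R (1 / 2 * (norm (V t))\<^sup>2 + f (\<phi> t)))"
        proof (cases "0 < t")
          case True
          have "c = 1 / 2 * (norm (V t))\<^sup>2 - f (\<phi> t)" using c[of t] True by (simp add: E_def power2_norm_eq_inner)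
          then show ?thesis using True nonneg[of "\<phi> t"] by (simp add: abs_le_iff)
        qed simp
      qed
    qed (intro borel_measurable_scaleR borel_measurable_indicator borel_measurable_const, simp)
    then have "integrable lebesgue (indicator {0::real<..} :: real \<Rightarrow> real)"
      using \<open>c \<noteq> 0\<close> by simp
    then show False using emeasure_lebesgue_half_line by (simp add: integrable_indicator_iff)
  qed
  with c[OF t] show ?thesis by (simp add: E_def power2_norm_eq_inner)
qed

text \<open>Of the two modes exp(\<mu> t) and exp(-\<mu> t) of the comparison equation for
  \<open>G\<close>, convergence to \<open>p\<close> excludes the growing one. By Newton's equation
  G'' is twice \<open>d t \<bullet> g (\<phi> t) + V t \<bullet> V t\<close>; coercivity bounds the
  first term below, and the second is nonnegative.\<close>

lemma newton_exponential_decay: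
  fixes \<phi> V :: "real \<Rightarrow> 'a::euclidean_space"
  assumes \<phi>: "\<And>t. 0 \<le> t \<Longrightarrow> (\<phi> has_vector_derivative V t) (at t within {0..})"
    and V: "\<And>t. 0 \<le> t \<Longrightarrow> (V has_vector_derivative g (\<phi> t)) (at t within {0..})"
    and energy: "\<And>t. 0 \<le> t \<Longrightarrow> (norm (V t))\<^sup>2 = 2 * f (\<phi> t)"
    and lim: "(\<phi> \<longlongrightarrow> p) at_top" and f: "continuous_on UNIV f"
    and pos: "0 < c" "0 < C" "0 < r"
    and coercive: "\<And>y. norm (y - p) < r \<Longrightarrow> c * (norm (y - p))\<^sup>2 \<le> (y - p) \<bullet> g y"
    and quadratic: "\<And>y. norm (y - p) < r \<Longrightarrow> f y \<le> C * (norm (y - p))\<^sup>2"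
  shows "\<exists>K \<mu>. K > 0 \<and> \<mu> > 0 \<and> (\<forall>t\<ge>0. norm (\<phi> t - p) + norm (V t) + \<bar>f (\<phi> t)\<bar> \<le> K * exp (- \<mu> * t))"
proof -
  have "\<forall>\<^sub>F t in at_top. dist (\<phi> t) p < r" using tendstoD[OF lim \<open>0 < r\<close>] .
  then obtain T0 where T0: "\<And>t. T0 \<le> t \<Longrightarrow> dist (\<phi> t) p < r"
    unfolding eventually_at_top_linorder by blast
  \<comment> \<open>\<open>T\<close> is at least 1, so later times are interior to the half line and
    one-sided derivatives become two-sided.\<close>
  define T where "T = max T0 1"
  have T: "0 < T" "\<And>t. T \<le> t \<Longrightarrow> norm (\<phi> t - p) < r" using T0 by (auto simp: T_def dist_norm)
  define \<mu> where "\<mu> = sqrt (2 * c)"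
  have \<mu>: "0 < \<mu>" "\<mu> * \<mu> = 2 * c" using pos by (auto simp: \<mu>_def)
  have interior: "at t within {0..} = at t" if "T \<le> t" for t :: real
    using that T(1) by (intro at_within_interior) simp
  define d where "d t = \<phi> t - p" for t
  have d: "(d has_vector_derivative V t) (at t)" if "T \<le> t" for t
    using has_vector_derivative_diff[OF \<phi>[of t] has_vector_derivative_const[of p]] that T(1) interior[OF that]
    by (simp add: d_def[abs_def])
  have dV: "(V has_vector_derivative g (\<phi> t)) (at t)" if "T \<le> t" for t
    using V[of t] that T(1) interior[OF that] by simp
  define G where "G t = d t \<bullet> d t" for t
  define w where "w t = 2 * (d t \<bullet> V t) + \<mu> * G t" for t
  have dG: "(G has_real_derivative 2 * (d t \<bullet> V t)) (at t)" if "T \<le> t" for t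
    using has_real_derivative_inner[OF d[OF that] d[OF that]] by (simp add: G_def[abs_def] inner_commute)
  have dw: "(w has_real_derivative 2 * (d t \<bullet> g (\<phi> t) + V t \<bullet> V t) + \<mu> * (2 * (d t \<bullet> V t))) (at t)" if "T \<le> t" for t
    unfolding w_def[abs_def]
    by (intro DERIV_add DERIV_cmult has_real_derivative_inner d dV dG that)
  \<comment> \<open>Here zero energy enters: the speed is at most of the order of the distance, so
    \<open>w\<close> is quadratic in \<open>d\<close> and tends to 0 with it.\<close>
  have Vle: "norm (V t) \<le> sqrt (2 * C) * norm (d t)" if "T \<le> t" for t
  proof -
    have "(norm (V t))\<^sup>2 \<le> 2 * C * (norm (d t))\<^sup>2"
      using energy[of t] quadratic[OF T(2)[OF that]] that T(1) by (simp add: d_def)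
    then have "norm (V t) \<le> sqrt (2 * C * (norm (d t))\<^sup>2)" by (rule real_le_rsqrt)
    then show ?thesis by (simp add: real_sqrt_mult)
  qed
  \<comment> \<open>The derivative of \<open>k\<close> is (G'' - \<mu>^2 G) exp(-\<mu> t): the terms
    \<mu> G' cancel, and the coercivity bound makes the rest nonnegative.\<close>
  define k where "k t = w t * exp (- \<mu> * t)" for t
  have k_mono: "k t \<le> k s" if "T \<le> t" "t \<le> s" for t s
  proof (rule DERIV_nonneg_imp_nondecreasing[OF that(2)])
    fix x assume "t \<le> x" "x \<le> s"
    then have x: "T \<le> x" using that by simp
    have "(k has_real_derivative (2 * (d x \<bullet> g (\<phi> x) + V x \<bullet> V x) + \<mu> * (2 * (d x \<bullet> V x))) * exp (- \<mu> * x)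
        + w x * (exp (- \<mu> * x) * - \<mu>)) (at x)"
      unfolding k_def[abs_def] using dw[OF x] by (auto intro!: derivative_eq_intros)
    moreover have "0 \<le> (2 * (d x \<bullet> g (\<phi> x) + V x \<bullet> V x) + \<mu> * (2 * (d x \<bullet> V x))) * exp (- \<mu> * x)
        + w x * (exp (- \<mu> * x) * - \<mu>)"
    proof -
      have "c * G x \<le> d x \<bullet> g (\<phi> x)"
        using coercive[OF T(2)[OF x]] by (simp add: d_def G_def power2_norm_eq_inner)
      moreover have "0 \<le> V x \<bullet> V x" by simp
      moreover have "\<mu> * (\<mu> * G x) = 2 * (c * G x)" using \<mu>(2) by (simp flip: mult.assoc)
      moreover have "\<mu> * w x = \<mu> * (2 * (d x \<bullet> V x)) + \<mu> * (\<mu> * G x)" by (simp add: w_def distrib_left)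
      \<comment> \<open>Stated for free reals, so that the products become atoms of linear
        arithmetic.\<close>
      moreover have "0 \<le> 2 * (X + Y) + Z - W" if "A \<le> X" "0 \<le> Y" "U = 2 * A" "W = Z + U"
        for X Y Z W U A :: real using that by simp
      ultimately have "0 \<le> 2 * (d x \<bullet> g (\<phi> x) + V x \<bullet> V x) + \<mu> * (2 * (d x \<bullet> V x)) - \<mu> * w x"
        by blast
      then have "0 \<le> (2 * (d x \<bullet> g (\<phi> x) + V x \<bullet> V x) + \<mu> * (2 * (d x \<bullet> V x)) - \<mu> * w x) * exp (- \<mu> * x)"
        by (rule mult_nonneg_nonneg) simp
      then show ?thesis by (simp add: algebra_simps)
    qed
    ultimately show "\<exists>y. (k has_real_derivative y) (at x) \<and> 0 \<le> y" by blast
  qed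
  have d0: "(d \<longlongrightarrow> 0) at_top" using lim unfolding d_def[abs_def] by (rule LIM_zero)
  have "(k \<longlongrightarrow> 0) at_top"
  proof (rule Lim_null_comparison)
    show "((\<lambda>t. (2 * sqrt (2 * C) + \<mu>) * (norm (d t))\<^sup>2) \<longlongrightarrow> 0) at_top"
      using tendsto_mult_left[OF tendsto_power[OF tendsto_norm_zero[OF d0], of 2], of "2 * sqrt (2 * C) + \<mu>"] by simp
    show "\<forall>\<^sub>F t in at_top. norm (k t) \<le> (2 * sqrt (2 * C) + \<mu>) * (norm (d t))\<^sup>2"
      using eventually_ge_at_top[of T]
    proof eventually_elim
      case (elim t)
      have "\<bar>d t \<bullet> V t\<bar> \<le> norm (d t) * norm (V t)" by (rule Cauchy_Schwarz_ineq2)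
      also have "\<dots> \<le> norm (d t) * (sqrt (2 * C) * norm (d t))" using Vle[OF elim] by (intro mult_left_mono) auto
      finally have 1: "\<bar>d t \<bullet> V t\<bar> \<le> sqrt (2 * C) * (norm (d t))\<^sup>2" by (simp add: power2_eq_square mult_ac)
      have "\<bar>w t\<bar> \<le> 2 * \<bar>d t \<bullet> V t\<bar> + \<mu> * (norm (d t))\<^sup>2"
        using \<mu>(1) unfolding w_def G_def power2_norm_eq_inner
        by (intro order_trans[OF abs_triangle_ineq]) (simp add: abs_mult)
      also have "\<dots> \<le> (2 * sqrt (2 * C) + \<mu>) * (norm (d t))\<^sup>2" using 1 by (simp add: distrib_right)
      finally have "\<bar>w t\<bar> \<le> (2 * sqrt (2 * C) + \<mu>) * (norm (d t))\<^sup>2" .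
      moreover have "\<bar>w t\<bar> * exp (- \<mu> * t) \<le> \<bar>w t\<bar> * 1"
        using \<mu>(1) elim T(1) by (intro mult_left_mono) auto
      ultimately show "norm (k t) \<le> (2 * sqrt (2 * C) + \<mu>) * (norm (d t))\<^sup>2"
        by (simp add: k_def abs_mult)
    qed
  qed
  then have "k t \<le> 0" if "T \<le> t" for t
  proof (rule tendsto_lowerbound)
    show "\<forall>\<^sub>F s in at_top. k t \<le> k s"
      using eventually_ge_at_top[of t] by eventually_elim (rule k_mono[OF that])
  qed simp
  then have w: "w t \<le> 0" if "T \<le> t" for t
    using that by (simp add: k_def mult_le_0_iff)
  have Gdecay: "G t * exp (\<mu> * t) \<le> G T * exp (\<mu> * T)" if "T \<le> t" for t
  proof (rule DERIV_nonpos_imp_nonincreasing[OF that])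
    fix x assume "T \<le> x" "x \<le> t"
    have "((\<lambda>t. G t * exp (\<mu> * t)) has_real_derivative w x * exp (\<mu> * x)) (at x)"
      using dG[OF \<open>T \<le> x\<close>] by (auto intro!: derivative_eq_intros simp: w_def algebra_simps)
    moreover have "w x * exp (\<mu> * x) \<le> 0" using w[OF \<open>T \<le> x\<close>] by (simp add: mult_le_0_iff)
    ultimately show "\<exists>y. ((\<lambda>t. G t * exp (\<mu> * t)) has_real_derivative y) (at x) \<and> y \<le> 0" by blast
  qed
  \<comment> \<open>\<open>G\<close> is a squared distance: taking the root halves the rate
    \<mu>.\<close>
  define D where "D = sqrt (G T * exp (\<mu> * T))"
  have ddecay: "norm (d t) \<le> D * exp (- (\<mu> / 2) * t)" if "T \<le> t" for t
  proof -
    have "(norm (d t) * exp (\<mu> / 2 * t))\<^sup>2 = G t * exp (\<mu> * t)"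
      by (simp add: power_mult_distrib G_def power2_norm_eq_inner flip: exp_double)
    then have "norm (d t) * exp (\<mu> / 2 * t) \<le> D"
      unfolding D_def using Gdecay[OF that] by (intro real_le_rsqrt) simp
    then have "norm (d t) * exp (\<mu> / 2 * t) * exp (- (\<mu> / 2) * t) \<le> D * exp (- (\<mu> / 2) * t)"
      by (rule mult_right_mono) simp
    then show ?thesis by (simp add: mult.assoc flip: exp_add)
  qed
  define N where "N t = norm (\<phi> t - p) + norm (V t) + \<bar>f (\<phi> t)\<bar>" for t
  have far: "N t \<le> (1 + sqrt (2 * C) + C * r) * D * exp (- (\<mu> / 2) * t)" if "T \<le> t" for t
  proof -
    \<comment> \<open>The energy identity shows \<open>2 * f (\<phi> t)\<close> to be a square,
      which gives the sign of \<open>f\<close> along the curve.\<close>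
    have "0 \<le> f (\<phi> t)" using energy[of t] that T(1) by (metis zero_le_power2 zero_le_mult_iff zero_less_numeral order.strict_trans2 less_imp_le not_less)
    \<comment> \<open>Within radius \<open>r\<close> the quadratic bound is weakened to a linear
      one, so that all three terms of \<open>N\<close> are bounded by multiples of
      \<open>norm (d t)\<close>.\<close>
    moreover have "f (\<phi> t) \<le> C * r * norm (d t)"
    proof -
      have "f (\<phi> t) \<le> C * (norm (d t))\<^sup>2" using quadratic[OF T(2)[OF that]] by (simp add: d_def)
      also have "\<dots> \<le> C * (r * norm (d t))"
        using T(2)[OF that] pos by (intro mult_left_mono) (auto simp: power2_eq_square d_def intro: mult_right_mono)
      finally show ?thesis by (simp add: mult_ac)
    qed
    ultimately have "N t \<le> (1 + sqrt (2 * C) + C * r) * norm (d t)"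
      using Vle[OF that] by (simp add: N_def d_def distrib_right)
    also have "\<dots> \<le> (1 + sqrt (2 * C) + C * r) * (D * exp (- (\<mu> / 2) * t))"
      using ddecay[OF that] pos by (intro mult_left_mono) auto
    finally show ?thesis by (simp add: mult_ac)
  qed
  have "continuous_on {0..} \<phi>" "continuous_on {0..} V"
    by (rule continuous_on_vector_derivative, use \<phi> V in auto)+
  then have c\<phi>: "continuous_on {0..T} \<phi>" and cV: "continuous_on {0..T} V"
    by (auto intro: continuous_on_subset)
  have "continuous_on {0..T} N"
    unfolding N_def[abs_def] using c\<phi> cV continuous_on_compose2[OF f c\<phi>] by (intro continuous_intros) auto
  then have "bounded (N ` {0..T})" by (intro compact_imp_bounded compact_continuous_image) auto
  then obtain B where B: "\<And>t. 0 \<le> t \<Longrightarrow> t \<le> T \<Longrightarrow> N t \<le> B"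
    unfolding bounded_iff by (metis abs_le_iff atLeastAtMost_iff imageI real_norm_def)
  have "0 \<le> B" using B[of 0] T(1) by (auto simp: N_def intro: order_trans[rotated])
  \<comment> \<open>Up to time \<open>T\<close> the compactness bound \<open>B\<close> suffices,
    since \<open>exp (\<mu> / 2 * (T - t))\<close> is at least 1 there.\<close>
  have near: "N t \<le> B * exp (\<mu> / 2 * T) * exp (- (\<mu> / 2) * t)" if "0 \<le> t" "t \<le> T" for t
  proof -
    have "1 \<le> exp (\<mu> / 2 * (T - t))" using that \<mu>(1) by simp
    then have "B * 1 \<le> B * exp (\<mu> / 2 * (T - t))" using \<open>0 \<le> B\<close> by (intro mult_left_mono)
    also have "\<dots> = B * exp (\<mu> / 2 * T) * exp (- (\<mu> / 2) * t)"
      by (simp add: right_diff_distrib mult.assoc flip: exp_add)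
    finally show ?thesis using B[OF that] by simp
  qed
  define K1 K2 where "K1 = (1 + sqrt (2 * C) + C * r) * D" "K2 = B * exp (\<mu> / 2 * T)"
  have K: "0 \<le> K1" "0 \<le> K2" using pos \<open>0 \<le> B\<close> by (auto simp: K1_K2_def D_def G_def)
  \<comment> \<open>\<open>K1\<close> and \<open>K2\<close> are only known to be nonnegative; the
    summand 1 makes the constant positive.\<close>
  have "N t \<le> (K1 + K2 + 1) * exp (- (\<mu> / 2) * t)" if "0 \<le> t" for t
  proof (cases "T \<le> t")
    case True
    have "N t \<le> K1 * exp (- (\<mu> / 2) * t)" using far[OF True] by (simp add: K1_K2_def)
    also have "\<dots> \<le> (K1 + K2 + 1) * exp (- (\<mu> / 2) * t)" using K by (intro mult_right_mono) auto
    finally show ?thesis .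
  next
    case False
    have "N t \<le> K2 * exp (- (\<mu> / 2) * t)" using near that False by (simp add: K1_K2_def)
    also have "\<dots> \<le> (K1 + K2 + 1) * exp (- (\<mu> / 2) * t)" using K by (intro mult_right_mono) auto
    finally show ?thesis .
  qed
  then show ?thesis
    using K \<mu>(1) unfolding N_def by (intro exI[of _ "K1 + K2 + 1"] exI[of _ "\<mu> / 2"]) auto
qed


section \<open>Minimizers\<close>

lemma partial_deriv_periodic:
  assumes "\<And>x. f (x + c) = f x"
  shows "partial_deriv i f (x + c) = partial_deriv i f x"
proof -
  have "f (x + c + s *\<^sub>R axis i 1) = f (x + s *\<^sub>R axis i 1)" for s
    using assms[of "x + s *\<^sub>R axis i 1"] by (simp add: add_ac)
  then show ?thesis by (simp add: partial_deriv_def)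
qed

text \<open>\<open>torus_hessian\<close> is evaluated at \<open>rep_torus\<close>, whereas the lift
  may converge to another representative; invariance under lattice translations passes to partial
  derivatives.\<close>

lemma torus_hessian_eq:
  assumes "abs_torus p = P"
  shows "torus_hessian Q P = hessian (\<lambda>x. Q (abs_torus x)) p"
proof -
  define q where "q x = Q (abs_torus x)" for x
  define c where "c = p - rep_torus P"
  have "torus_rel p (rep_torus P)"
    using assms by (simp flip: abs_torus_eq_iff)
  then have "torus_rel (x + c) x" for x by (simp add: torus_rel_def c_def)
  then have "abs_torus (x + c) = abs_torus x" for x by (simp add: abs_torus_eq_iff)
  then have "q (x + c) = q x" for x by (simp add: q_def)
  then have "partial_deriv i (partial_deriv j q) (rep_torus P + c) = partial_deriv i (partial_deriv j q) (rep_torus P)" for i j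
    by (intro partial_deriv_periodic)
  moreover have "rep_torus P + c = p" by (simp add: c_def)
  ultimately have "hessian q p = hessian q (rep_torus P)" by (simp add: hessian_def)
  then show ?thesis by (simp add: torus_hessian_def q_def[abs_def])
qed

text \<open>Some coordinate differs by a nonzero multiple of 2 pi. The weaker bound 2 is what makes
  unit balls around distinct points of a fibre disjoint.\<close>

lemma torus_fibre_separated:
  assumes "abs_torus x = abs_torus y" "x \<noteq> y"
  shows "2 < norm (x - y)"
proof -
  obtain i where i: "x $ i \<noteq> y $ i" using assms(2) by (auto simp: vec_eq_iff)
  obtain k where k: "x $ i - y $ i = 2 * pi * of_int k" using abs_torus_eqD[OF assms(1)] .
  with i have "k \<noteq> 0" by auto
  then have "1 \<le> \<bar>real_of_int k\<bar>" by linarith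
  then have "2 * pi \<le> \<bar>(x - y) $ i\<bar>" using k by (simp add: abs_mult)
  also have "\<dots> \<le> norm (x - y)" by (rule component_le_norm_cart)
  finally show ?thesis using pi_gt3 by linarith
qed

text \<open>Nearby representatives given by the infimum in the distance are translated together by
  the lattice vector that carries the first one to \<open>x\<close>.\<close>

lemma dist_torus_lift:
  fixes q :: "'n::finite torus"
  assumes "dist (abs_torus x) q < e"
  obtains p where "abs_torus p = q" "norm (x - p) < e"
proof -
  obtain x' y where xy: "abs_torus x' = abs_torus x" "abs_torus y = q" "norm (x' - y) < e"
    using assms by (rule dist_torus_approx)
  have "torus_rel x x'" using xy(1) by (simp flip: abs_torus_eq_iff)
  then have "torus_rel (y + (x - x')) y" by (simp add: torus_rel_def)
  then have "abs_torus (y + (x - x')) = q" using xy(2) by (simp flip: abs_torus_eq_iff)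
  moreover have "x - (y + (x - x')) = x' - y" by simp
  ultimately show thesis using that[of "y + (x - x')"] xy(3) by simp
qed

text \<open>For large times the lift lies in the union of the unit balls around the fibre of
  \<open>P\<close>. These are disjoint and the image of a half line is connected, so the lift stays
  in one of them, and the fibre points that it approaches must be the centre \<open>p\<close> of
  that ball.\<close>

lemma torus_lift_tendsto:
  fixes \<phi> :: "real \<Rightarrow> real ^ 'n"
  assumes \<phi>: "continuous_on {0..} \<phi>" "\<forall>t\<ge>0. abs_torus (\<phi> t) = \<Phi> t"
    and lim: "(\<Phi> \<longlongrightarrow> P) at_top"
  obtains p where "abs_torus p = P" "(\<phi> \<longlongrightarrow> p) at_top"
proof -
  have near: "\<exists>T\<ge>0. \<forall>t\<ge>T. \<exists>p. abs_torus p = P \<and> norm (\<phi> t - p) < e" if e: "0 < e" for e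
  proof -
    obtain T where T: "\<forall>t\<ge>T. dist (\<Phi> t) P < e"
      using tendstoD[OF lim e] unfolding eventually_at_top_linorder by blast
    have "\<exists>p. abs_torus p = P \<and> norm (\<phi> t - p) < e" if "t \<ge> max T 0" for t
    proof -
      have "dist (abs_torus (\<phi> t)) P < e" using T \<phi>(2) that by simp
      then show ?thesis using dist_torus_lift by blast
    qed
    then show ?thesis by (intro exI[of _ "max T 0"]) auto
  qed
  obtain T where T: "T \<ge> 0" "\<And>t. t \<ge> T \<Longrightarrow> \<exists>p. abs_torus p = P \<and> norm (\<phi> t - p) < 1"
    using near[of 1] by auto
  obtain p where p: "abs_torus p = P" "norm (\<phi> T - p) < 1" using T(2)[of T] by auto
  have stay: "norm (\<phi> t - p) < 1" if t: "t \<ge> T" for t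
  proof -
    let ?A = "ball p 1" and ?B = "\<Union>p'\<in>{p'. abs_torus p' = P \<and> p' \<noteq> p}. ball p' 1"
    have "connected (\<phi> ` {T..})"
      using \<phi>(1) T(1) by (intro connected_continuous_image) (auto intro: continuous_on_subset convex_connected)
    moreover have "?A \<inter> ?B \<inter> \<phi> ` {T..} = {}"
    proof -
      have False if "x \<in> ball p 1" "x \<in> ball p' 1" "abs_torus p' = P" "p' \<noteq> p" for x p'
      proof -
        have "norm (p' - p) < 2"
          using that(1,2) dist_triangle2[of p' p x] by (simp add: dist_norm norm_minus_commute)
        then show False using torus_fibre_separated[of p' p] p(1) that by simp
      qed
      then show ?thesis by blast
    qed
    moreover have "\<phi> ` {T..} \<subseteq> ?A \<union> ?B"
    proof
      fix x assume "x \<in> \<phi> ` {T..}"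
      then obtain p' where "abs_torus p' = P" "x \<in> ball p' 1"
        using T(2) by (auto simp: dist_norm norm_minus_commute)
      then show "x \<in> ?A \<union> ?B" by (cases "p' = p") auto
    qed
    ultimately have "?A \<inter> \<phi> ` {T..} = {} \<or> ?B \<inter> \<phi> ` {T..} = {}"
      by (intro connectedD) auto
    moreover have "\<phi> T \<in> ?A \<inter> \<phi> ` {T..}" using p(2) by (auto simp: dist_norm norm_minus_commute)
    ultimately have "?B \<inter> \<phi> ` {T..} = {}" by blast
    moreover have "\<phi> t \<in> \<phi> ` {T..}" using t by simp
    ultimately have "\<phi> t \<in> ?A" using \<open>\<phi> ` {T..} \<subseteq> ?A \<union> ?B\<close> by blast
    then show ?thesis by (simp add: dist_norm norm_minus_commute)
  qed
  have "(\<phi> \<longlongrightarrow> p) at_top"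
  proof (rule tendstoI)
    fix e :: real assume "0 < e"
    then obtain T' where T': "\<And>t. t \<ge> T' \<Longrightarrow> \<exists>p. abs_torus p = P \<and> norm (\<phi> t - p) < min e 1"
      using near[of "min e 1"] by auto
    show "\<forall>\<^sub>F t in at_top. dist (\<phi> t) p < e"
      using eventually_ge_at_top[of "max T T'"]
    proof eventually_elim
      case (elim t)
      then obtain p' where p': "abs_torus p' = P" "norm (\<phi> t - p') < min e 1" using T' by auto
      have "norm (p' - p) < 2"
        using stay[of t] elim p'(2) norm_triangle_ineq[of "p' - \<phi> t" "\<phi> t - p"] by (simp add: norm_minus_commute)
      then have "p' = p" using torus_fibre_separated[of p' p] p(1) p'(1) by force
      with p'(2) show ?case by (simp add: dist_norm)
    qed
  qed
  with p(1) show thesis by (rule that)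
qed

text \<open>The weak velocity agrees with \<open>V\<close> only almost everywhere, but \<phi> is
  continuous, so its equality with an antiderivative of \<open>V\<close> holds at all times
  including 0. The last conclusion restates finiteness of the action with \<open>V\<close>, as the
  energy argument needs it.\<close>

lemma minimizer_newton:
  fixes Q :: "'n::finite torus \<Rightarrow> real"
  assumes q_def: "\<And>x. q x = Q (abs_torus x)" and q: "real_analytic q" and min: "global_minimizer Q \<Phi>0 \<Phi>"
  obtains \<phi> V where "\<forall>t\<ge>0. abs_torus (\<phi> t) = \<Phi> t"
    "\<forall>t\<ge>0. (\<phi> has_vector_derivative V t) (at t within {0..})"
    "\<forall>t\<ge>0. (V has_vector_derivative grad q (\<phi> t)) (at t within {0..})"
    "set_integrable lebesgue {0<..} (\<lambda>t. 1 / 2 * (norm (V t))\<^sup>2 + q (\<phi> t))"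
proof -
  define u where "u = weak_velocity \<Phi>"
  have adm: "\<Phi> \<in> admissible Q \<Phi>0" using min by (simp add: global_minimizer_def)
  then obtain u' where "weak_velocity_of \<Phi> u'" by (auto simp: admissible_def H1_loc_def)
  then have "weak_velocity_of \<Phi> u" unfolding u_def by (rule weak_velocity_AE(1))
  then obtain \<phi> where \<phi>: "continuous_on {0..} \<phi>" "\<forall>t\<ge>0. abs_torus (\<phi> t) = \<Phi> t"
    and u: "\<forall>T>0. L2_on {0<..<T} u" "has_weak_derivative_on \<phi> u {0<..}"
    unfolding weak_velocity_of_iff by blast
  have lu: "locally_integrable u" using L2_on_locally_integrable u(1) by blast
  have cG: "continuous_on {0..} (\<lambda>t. grad q (\<phi> t))"
    using continuous_on_compose2[OF continuous_on_grad[OF q, of UNIV] \<phi>(1)] by auto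
  have weak_u: "(LINT t:{0<..}|lebesgue. deriv \<eta> t *\<^sub>R u t) = - (LINT t:{0<..}|lebesgue. \<eta> t *\<^sub>R grad q (\<phi> t))"
    if \<eta>: "test_function_on {0<..} \<eta>" for \<eta>
  proof -
    let ?X = "LINT t:{0<..}|lebesgue. deriv \<eta> t *\<^sub>R u t + \<eta> t *\<^sub>R grad q (\<phi> t)"
    \<comment> \<open>The direction of the variation is the integral itself, which must therefore
      vanish.\<close>
    have "?X \<bullet> ?X = 0"
      by (rule minimizer_first_variation[OF q_def q min \<phi> u u_def \<eta>])
    then have "?X = 0" by (simp only: inner_eq_zero_iff)
    then show ?thesis
      using test_function_integrable(2)[OF lu \<eta>] test_function_integrable(1)[OF locally_integrable_continuous[OF cG] \<eta>]
      by (simp add: eq_neg_iff_add_eq_0)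
  qed
  obtain V where V: "\<forall>t\<ge>0. (V has_vector_derivative grad q (\<phi> t)) (at t within {0..})"
    and uV: "AE t in lebesgue. 0 < t \<longrightarrow> u t = V t"
    using weak_derivative_antiderivative[OF lu cG weak_u] by metis
  have cV: "continuous_on {0..} V"
    by (rule continuous_on_vector_derivative) (use V in auto)
  \<comment> \<open>Changing the velocity on a null set keeps it a weak derivative of \<phi>, now a
    continuous one, so the antiderivative lemma applies again.\<close>
  have weak_\<phi>: "(LINT t:{0<..}|lebesgue. deriv \<eta> t *\<^sub>R \<phi> t) = - (LINT t:{0<..}|lebesgue. \<eta> t *\<^sub>R V t)"
    if \<eta>: "test_function_on {0<..} \<eta>" for \<eta>
  proof -
    have "AE t in lebesgue. t \<in> {0<..} \<longrightarrow> \<eta> t *\<^sub>R u t = \<eta> t *\<^sub>R V t"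
      using uV by eventually_elim auto
    from set_integrable_AE_cong(2)[OF test_function_integrable(1)[OF lu \<eta>] this]
    show ?thesis using u(2) \<eta> by (simp add: has_weak_derivative_on_def)
  qed
  obtain F where F: "\<forall>t\<ge>0. (F has_vector_derivative V t) (at t within {0..})"
    and \<phi>F: "AE t in lebesgue. 0 < t \<longrightarrow> \<phi> t = F t"
    using weak_derivative_antiderivative[OF locally_integrable_continuous[OF \<phi>(1)] cV weak_\<phi>] by metis
  have cF: "continuous_on {0..} F"
    by (rule continuous_on_vector_derivative) (use F in auto)
  have eq: "\<phi> t = F t" if "t \<ge> 0" for t by (rule continuous_on_AE_eq[OF \<phi>(1) cF \<phi>F that])
  have d\<phi>: "\<forall>t\<ge>0. (\<phi> has_vector_derivative V t) (at t within {0..})"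
  proof (intro allI impI)
    fix t :: real assume "0 \<le> t"
    then show "(\<phi> has_vector_derivative V t) (at t within {0..})"
      using has_vector_derivative_transform[of t "{0..}" \<phi> F "V t"] F eq by simp
  qed
  have "set_integrable lebesgue {0<..} (lagrangian Q \<Phi>)" using adm by (simp add: admissible_def)
  moreover have "AE t in lebesgue. t \<in> {0<..} \<longrightarrow> lagrangian Q \<Phi> t = 1 / 2 * (norm (V t))\<^sup>2 + q (\<phi> t)"
    using uV by eventually_elim (use \<phi>(2) in \<open>auto simp: lagrangian_def u_def q_def\<close>)
  ultimately have "set_integrable lebesgue {0<..} (\<lambda>t. 1 / 2 * (norm (V t))\<^sup>2 + q (\<phi> t))"
    by (rule set_integrable_AE_cong(1))
  from that[OF \<phi>(2) d\<phi> V this] show thesis .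
qed

theorem proposition6:
  fixes Q :: "'n::finite torus \<Rightarrow> real"
    and \<Phi>0 \<Phi>bar :: "'n torus"
    and \<Phi> :: "real \<Rightarrow> 'n torus"
  assumes "torus_real_analytic Q"
    and "\<And>p. 0 \<le> Q p"
    and "{p. Q p = 0} \<noteq> {}"
    and "finite {p. Q p = 0}"
    and "global_minimizer Q \<Phi>0 \<Phi>"
    and "\<Phi>bar \<in> {p. Q p = 0}"
    and "(\<Phi> \<longlongrightarrow> \<Phi>bar) at_top"
    and "positive_definite (torus_hessian Q \<Phi>bar)"
  shows "\<exists>C \<mu>. C > 0 \<and> \<mu> > 0 \<and>
    (\<forall>t\<ge>0. \<exists>v. has_velocity \<Phi> v t \<and>
       dist (\<Phi> t) \<Phi>bar + norm v + \<bar>Q (\<Phi> t)\<bar> \<le> C * exp (- \<mu> * t))"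
proof -
  define q where "q x = Q (abs_torus x)" for x
  have q: "real_analytic q" using assms(1) by (simp add: torus_real_analytic_def q_def[abs_def])
  obtain \<phi> V where \<phi>: "\<forall>t\<ge>0. abs_torus (\<phi> t) = \<Phi> t"
    and "\<forall>t\<ge>0. (\<phi> has_vector_derivative V t) (at t within {0..})"
    and "\<forall>t\<ge>0. (V has_vector_derivative grad q (\<phi> t)) (at t within {0..})"
    and int: "set_integrable lebesgue {0<..} (\<lambda>t. 1 / 2 * (norm (V t))\<^sup>2 + q (\<phi> t))"
    by (rule minimizer_newton[OF q_def q assms(5)])
  then have d\<phi>: "\<And>t. 0 \<le> t \<Longrightarrow> (\<phi> has_vector_derivative V t) (at t within {0..})"
    and dV: "\<And>t. 0 \<le> t \<Longrightarrow> (V has_vector_derivative grad q (\<phi> t)) (at t within {0..})"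
    by blast+
  have "continuous_on {0..} \<phi>"
    by (rule continuous_on_vector_derivative) (use d\<phi> in auto)
  then obtain p where p: "abs_torus p = \<Phi>bar" "(\<phi> \<longlongrightarrow> p) at_top"
    using torus_lift_tendsto[OF _ \<phi> assms(7)] by metis
  have nonneg: "0 \<le> q x" for x using assms(2) by (simp add: q_def)
  have "q p = 0" using p(1) assms(6) by (simp add: q_def)
  moreover have "positive_definite (hessian q p)"
    using assms(8) torus_hessian_eq[OF p(1), of Q] by (simp add: q_def[abs_def])
  ultimately obtain c C r where pos: "0 < c" "0 < C" "0 < r"
    and bounds: "\<forall>y. norm (y - p) < r \<longrightarrow>
      c * (norm (y - p))\<^sup>2 \<le> (y - p) \<bullet> grad q y \<and> q y \<le> C * (norm (y - p))\<^sup>2"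
    using nondegenerate_zero_bounds[OF q nonneg] by metis
  have energy: "(norm (V t))\<^sup>2 = 2 * q (\<phi> t)" if "0 \<le> t" for t
    by (rule newton_energy_zero[OF d\<phi> dV real_analytic_has_derivative_grad[OF q] nonneg int that])
  have "\<exists>K \<mu>. K > 0 \<and> \<mu> > 0 \<and> (\<forall>t\<ge>0. norm (\<phi> t - p) + norm (V t) + \<bar>q (\<phi> t)\<bar> \<le> K * exp (- \<mu> * t))"
    by (rule newton_exponential_decay[OF d\<phi> dV energy p(2) real_analytic_continuous_on[OF q] pos])
      (use bounds in auto)
  then obtain K \<mu> where K: "K > 0" "\<mu> > 0"
    "\<forall>t\<ge>0. norm (\<phi> t - p) + norm (V t) + \<bar>q (\<phi> t)\<bar> \<le> K * exp (- \<mu> * t)"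
    by blast
  show ?thesis
  proof (rule exI[of _ K], rule exI[of _ \<mu>], intro conjI K(1,2) allI impI)
    fix t :: real assume t: "0 \<le> t"
    show "\<exists>v. has_velocity \<Phi> v t \<and> dist (\<Phi> t) \<Phi>bar + norm v + \<bar>Q (\<Phi> t)\<bar> \<le> K * exp (- \<mu> * t)"
    proof (intro exI[of _ "V t"] conjI)
      show "has_velocity \<Phi> (V t) t" unfolding has_velocity_def using \<phi> d\<phi>[OF t] by blast
      \<comment> \<open>The quotient distance is an infimum over representatives, so the Euclidean
        decay of the lift bounds it.\<close>
      have "dist (\<Phi> t) \<Phi>bar \<le> norm (\<phi> t - p)"
        using dist_torus_lower[of "\<phi> t" p] \<phi> t p(1) by simp
      moreover have "Q (\<Phi> t) = q (\<phi> t)" using \<phi> t by (simp add: q_def)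
      ultimately show "dist (\<Phi> t) \<Phi>bar + norm (V t) + \<bar>Q (\<Phi> t)\<bar> \<le> K * exp (- \<mu> * t)"
        using K(3) t by force
    qed
  qed
qed

end
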